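(* Let $\omega = \frac{1+\sqrt{-43}}{2}$ and $\mathcal{O}_{-43} = \mathbb{Z}[\omega]$. Then the group $\Gamma_{-43} = PSL_2(\mathcal{O}_{-43})$ has the presentation $$\begin{split} \Gamma_{-43} = \langle A, B, U, R, S \mid\ & B^2,\ (BA)^3,\ AUA^{-1}U^{-1},\ (R^{-1} U)^3, \\ & A^{-1} R A^{-1} U^{-1} R A^{-1} R^{-1} U R^{-1}, \\ & A^{-1} R U^{-1} S R^{-1} U B S^{-1} B, \\ & (U A S^{-1} B S R^{-1})^2, \\ & (B S U^{-1} R S^{-1} A)^2, \\ & A^{-1} U^{-1} S R^{-1} U S^{-1} B A^{-1} S R^{-1} U S^{-1} B U, \\ & U B U^{-1} A^{-1} R S^{-1} B S A^{-1} B S^{-1} B U R^{-1} A S R^{-1} \rangle , \end{split}$$ where the generators are represented by (are the images in $PSL_2(\mathcal{O}_{-43})$ of) the matrices $$A = \begin{bmatrix} 1 & 1 \\ 0 & 1 \end{bmatrix},\quad B = \begin{bmatrix} 0 & 1 \\ -1 & 0 \end{bmatrix},\quad U = \begin{bmatrix} 1 & \omega \\ 0 & 1 \end{bmatrix},\quad R = \begin{bmatrix} 1 + \omega & \omega - 6 \\ 2 & \omega \end{bmatrix},\quad S = \begin{bmatrix} 3 & \omega \\ 1 - \omega & 4 \end{bmatrix}.$$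
   Context: $\mathcal{O}_d$ denotes the ring of integers of $\mathbb{Q}(\sqrt{d})$; for $d=-43$ it equals $\mathbb{Z}[\omega]$ with $\omega = (1+\sqrt{-43})/2$. $PSL_2(\mathcal{O}) = SL_2(\mathcal{O})/\{\pm I\}$. Saying that the presentation holds with the generators represented by the given matrices means that the homomorphism from the abstractly presented group to $PSL_2(\mathcal{O}_{-43})$ sending each generator to the class of the indicated matrix is well defined and an isomorphism. *)

theory Defs
  imports
    "HOL-Analysis.Analysis"
    "HOL-Algebra.Coset"
    "HOL-Computational_Algebra.Computational_Algebra"
begin

section \<open>Free groups and group presentations\<close>

datatype 'g letter = Gen 'g | Inv 'g

fun inv_letter :: "'g letter \<Rightarrow> 'g letter" where
  "inv_letter (Gen x) = Inv x"
| "inv_letter (Inv x) = Gen x"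

fun freely_reduced :: "'g letter list \<Rightarrow> bool" where
  "freely_reduced [] \<longleftrightarrow> True"
| "freely_reduced [x] \<longleftrightarrow> True"
| "freely_reduced (x # y # w) \<longleftrightarrow> y \<noteq> inv_letter x \<and> freely_reduced (y # w)"

fun push :: "'g letter \<Rightarrow> 'g letter list \<Rightarrow> 'g letter list" where
  "push x [] = [x]"
| "push x (y # w) = (if y = inv_letter x then w else x # y # w)"

definition reduce :: "'g letter list \<Rightarrow> 'g letter list" where
  "reduce w = foldr push w []"

text \<open>The free group on the set of all elements of the type \<open>'g\<close>.\<close>

definition free_group :: "'g letter list monoid" where
  "free_group =
     \<lparr>carrier = {w. freely_reduced w}, monoid.mult = (\<lambda>v w. reduce (v @ w)), one = []\<rparr>"

definition normal_closure :: "('a, 'b) monoid_scheme \<Rightarrow> 'a set \<Rightarrow> 'a set" where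
  "normal_closure G X = \<Inter>{N. N \<lhd> G \<and> X \<subseteq> N}"

text \<open>Relators may be given as arbitrary, not necessarily reduced, words.\<close>

definition relator_closure :: "'g letter list set \<Rightarrow> 'g letter list set" where
  "relator_closure Rels = normal_closure free_group (reduce ` Rels)"

definition presented_group :: "'g letter list set \<Rightarrow> 'g letter list set monoid" where
  "presented_group Rels = free_group Mod relator_closure Rels"

definition presented_gen :: "'g letter list set \<Rightarrow> 'g \<Rightarrow> 'g letter list set" where
  "presented_gen Rels x = relator_closure Rels #>\<^bsub>free_group\<^esub> [Gen x]"

definition has_presentation ::
  "('a, 'b) monoid_scheme \<Rightarrow> 'g letter list set \<Rightarrow> ('g \<Rightarrow> 'a) \<Rightarrow> bool" where
  "has_presentation G Rels f \<longleftrightarrow>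
     (\<exists>\<phi> \<in> iso (presented_group Rels) G. \<forall>x. \<phi> (presented_gen Rels x) = f x)"

lemma inv_letter_inv_letter [simp]: "inv_letter (inv_letter x) = x"
  by (cases x) auto

lemma freely_reduced_Cons: "freely_reduced (x # w) \<Longrightarrow> freely_reduced w"
  by (cases w) auto

lemma freely_reduced_push [simp]: "freely_reduced w \<Longrightarrow> freely_reduced (push x w)"
  by (cases w) (auto intro: freely_reduced_Cons)

lemma push_cancel: "freely_reduced w \<Longrightarrow> push (inv_letter x) (push x w) = w"
  by (cases "(x, w)" rule: push.cases; cases "tl w") auto

lemma push_cancel': "freely_reduced w \<Longrightarrow> push x (push (inv_letter x) w) = w"
  using push_cancel[of w "inv_letter x"] by simp

lemma freely_reduced_foldr_push [simp]: "freely_reduced w \<Longrightarrow> freely_reduced (foldr push v w)"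
  by (induction v) auto

lemma freely_reduced_reduce [simp]: "freely_reduced (reduce w)"
  by (simp add: reduce_def)

lemma reduce_freely_reduced: "freely_reduced w \<Longrightarrow> reduce w = w"
proof (induction w)
  case (Cons x w)
  then show ?case
    by (cases w) (auto simp: reduce_def)
qed (simp add: reduce_def)

lemma foldr_push_push:
  "freely_reduced w \<Longrightarrow> foldr push (push x v) w = push x (foldr push v w)"
  by (cases v) (auto simp: push_cancel')

lemma foldr_push_reduce: "freely_reduced w \<Longrightarrow> foldr push (reduce v) w = foldr push v w"
  by (induction v) (auto simp: reduce_def foldr_push_push)

lemma foldr_push_inverse:
  "freely_reduced u \<Longrightarrow> foldr push (rev (map inv_letter w)) (foldr push w u) = u"
  by (induction w) (auto simp: push_cancel)

lemma group_free_group: "group (free_group :: 'g letter list monoid)"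
proof (rule groupI)
  fix x y z :: "'g letter list"
  assume "x \<in> carrier free_group" "y \<in> carrier free_group" "z \<in> carrier free_group"
  then have "freely_reduced z" by (simp add: free_group_def)
  then show "x \<otimes>\<^bsub>free_group\<^esub> y \<otimes>\<^bsub>free_group\<^esub> z = x \<otimes>\<^bsub>free_group\<^esub> (y \<otimes>\<^bsub>free_group\<^esub> z)"
    using foldr_push_reduce[of z "x @ y"] reduce_freely_reduced[of z]
      reduce_freely_reduced[of "foldr push y z"]
    by (simp add: free_group_def) (simp add: reduce_def)
next
  fix x :: "'g letter list"
  assume "x \<in> carrier free_group"
  have "reduce (reduce (rev (map inv_letter x)) @ x) = []"
    by (simp add: reduce_def foldr_push_reduce[unfolded reduce_def] foldr_push_inverse)
  then show "\<exists>y \<in> carrier free_group. y \<otimes>\<^bsub>free_group\<^esub> x = \<one>\<^bsub>free_group\<^esub>"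
    by (intro bexI[of _ "reduce (rev (map inv_letter x))"]) (simp_all add: free_group_def)
qed (auto simp: free_group_def reduce_freely_reduced)

lemma (in group) normal_normal_closure:
  assumes "X \<subseteq> carrier G"
  shows "normal_closure G X \<lhd> G"
proof -
  have G: "carrier G \<lhd> G"
    by (auto simp: normal_inv_iff intro: subgroup_self)
  have "subgroup (normal_closure G X) G"
    unfolding normal_closure_def using G assms
    by (intro subgroups_Inter) (auto simp: normal_imp_subgroup)
  then show ?thesis
    by (auto simp: normal_inv_iff normal_closure_def)
qed

section \<open>Imaginary quadratic integers and projective special linear groups\<close>

definition quadratic_field :: "int \<Rightarrow> complex set" where
  "quadratic_field d = {of_rat a + of_rat b * csqrt (of_int d) | a b. True}"

definition quadratic_integers :: "int \<Rightarrow> complex set" where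
  "quadratic_integers d = {z \<in> quadratic_field d. algebraic_int z}"

definition SL2 :: "complex set \<Rightarrow> (complex^2^2) monoid" where
  "SL2 \<O> =
     \<lparr>carrier = {M. (\<forall>i j. M $ i $ j \<in> \<O>) \<and> det M = 1}, monoid.mult = (**), one = mat 1\<rparr>"

definition PSL2 :: "complex set \<Rightarrow> (complex^2^2) set monoid" where
  "PSL2 \<O> = SL2 \<O> Mod {mat 1, - mat 1}"

definition PSL2_class :: "complex set \<Rightarrow> complex^2^2 \<Rightarrow> (complex^2^2) set" where
  "PSL2_class \<O> M = {mat 1, - mat 1} #>\<^bsub>SL2 \<O>\<^esub> M"

section \<open>The generators and relators\<close>

definition omega :: complex where
  "omega = (1 + csqrt (-43)) / 2"

lemma csqrt_43: "csqrt (-43) = \<i> * of_real (sqrt 43)"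
  using csqrt_of_real_nonpos[of "-43"] by simp

lemma omega_square: "omega * omega = omega - 11"
proof -
  have "csqrt (-43) * csqrt (-43) = -43"
    by (metis power2_csqrt power2_eq_square)
  then show ?thesis by (simp add: omega_def field_simps)
qed

lemma monic_factor_int_poly:
  fixes p :: "int poly" and q h :: "rat poly"
  assumes "lead_coeff p = 1" "lead_coeff q = 1" "map_poly rat_of_int p = q * h"
  shows "\<exists>Q. q = map_poly rat_of_int Q"
proof -
  have ex: "\<exists>n>0. \<exists>R. smult (of_int n) r = map_poly rat_of_int R" for r :: "rat poly"
  proof (induction r)
    case 0
    show ?case by (intro exI[of _ 1] conjI exI[of _ 0]) auto
  next
    case (pCons c r)
    then obtain n R where n: "n > 0" "smult (of_int n) r = map_poly rat_of_int R" by blast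
    obtain u v where uv: "quotient_of c = (u, v)" by fastforce
    then have v: "v > 0" "c = of_int u / of_int v"
      using quotient_of_denom_pos quotient_of_div by auto
    have R: "smult (of_int (v * n)) r = map_poly rat_of_int (smult v R)"
      using arg_cong[OF n(2), of "smult (of_int v)"]
      by (simp add: map_poly_smult)
    have "smult (of_int (v * n)) (pCons c r) = map_poly rat_of_int (pCons (n * u) (smult v R))"
      using R v by (simp add: map_poly_pCons)
    moreover have "v * n > 0" using v n by simp
    ultimately show ?case by blast
  qed
  obtain n Q where n: "n > 0" and Q: "smult (of_int n) q = map_poly rat_of_int Q"
    using ex by blast
  obtain m H where m: "m > 0" and H: "smult (of_int m) h = map_poly rat_of_int H"
    using ex by blast
  have mult: "map_poly rat_of_int (X * Y) = map_poly rat_of_int X * map_poly rat_of_int Y" for X Y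
    by (simp add: poly_eq_iff coeff_map_poly coeff_mult)
  have "map_poly rat_of_int (smult (n * m) p) = smult (of_int (n * m)) (q * h)"
    using assms(3) by (simp add: poly_eq_iff coeff_map_poly)
  also have "\<dots> = map_poly rat_of_int (Q * H)"
    by (simp add: mult flip: Q H) (simp add: mult.commute)
  finally have eq: "smult (n * m) p = Q * H"
    by (simp add: poly_eq_iff coeff_map_poly flip: of_int_mult)
  have lead_Q: "lead_coeff Q = n"
  proof -
    have "degree Q = degree q"
      by (metis Q degree_map_poly degree_smult_eq n of_int_eq_0_iff order_less_irrefl)
    then show ?thesis
      using arg_cong[OF Q, of "\<lambda>r. coeff r (degree q)"] assms(2) by (simp add: coeff_map_poly)
  qed
  have lead_h: "lead_coeff h = 1"
  proof -
    have "lead_coeff (map_poly rat_of_int p) = 1"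
      using assms(1) by (simp add: coeff_map_poly degree_map_poly)
    then show ?thesis using assms(2,3) by (simp add: lead_coeff_mult)
  qed
  have lead_H: "lead_coeff H = m"
  proof -
    have "degree H = degree h"
      by (metis H degree_map_poly degree_smult_eq m of_int_eq_0_iff order_less_irrefl)
    then show ?thesis
      using arg_cong[OF H, of "\<lambda>r. coeff r (degree h)"] lead_h by (simp add: coeff_map_poly)
  qed
  have "content p = 1"
    using content_dvd_coeff[of p "degree p"] assms(1) is_unit_content_iff[of p] by simp
  then have nm: "n * m = content Q * content H"
    using arg_cong[OF eq, of content] n m by (simp add: content_mult)
  have "content Q dvd n" "content H dvd m"
    using content_dvd_coeff[of Q "degree Q"] content_dvd_coeff[of H "degree H"] lead_Q lead_H
    by simp_all
  then obtain k l where kl: "n = content Q * k" "m = content H * l"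
    unfolding dvd_def by blast
  have "content Q * content H * (k * l) = content Q * content H * 1"
    using nm kl by (simp add: mult_ac)
  moreover have "content Q * content H \<noteq> 0"
    using nm n m by auto
  ultimately have "k * l = 1" by simp
  moreover have "content Q \<ge> 0"
    using normalize_content[of Q] by simp
  then have "k > 0"
    using kl(1) n by (simp add: zero_less_mult_iff)
  ultimately have "k = 1"
    using zmult_eq_1_iff by auto
  then have "Q = smult n (primitive_part Q)"
    using kl(1) content_times_primitive_part[of Q] by simp
  then have "map_poly rat_of_int Q = smult (of_int n) (map_poly rat_of_int (primitive_part Q))"
    using map_poly_smult[of rat_of_int n "primitive_part Q"] by simp
  then have "q = map_poly rat_of_int (primitive_part Q)"
    using n Q smult_cancel[of "rat_of_int n"] by simp
  then show ?thesis by blast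
qed

text \<open>The ring of integers of \<open>\<rat>(\<surd>-43)\<close> is \<open>\<int>[\<omega>]\<close>.\<close>

lemma quadratic_integers_43:
  "quadratic_integers (-43) = {of_int a + of_int b * omega | a b. True}"
proof (intro equalityI subsetI)
  fix z assume "z \<in> {of_int a + of_int b * omega | a b. True}"
  then obtain a b where z: "z = of_int a + of_int b * omega" by blast
  let ?p = "[:a^2 + a*b + 11*b^2, -(2*a + b), 1:] :: int poly"
  have "poly (map_poly of_int ?p) z = of_int b ^ 2 * (omega * omega - (omega - 11))"
    by (simp add: z map_poly_pCons algebra_simps power2_eq_square)
  then have "poly (map_poly of_int ?p) z = 0" by (simp add: omega_square)
  then have "algebraic_int z"
    unfolding algebraic_int_altdef_ipoly by (intro exI[of _ ?p]) simp
  moreover have "z = of_rat (of_int a + of_int b / 2) + of_rat (of_int b / 2) * csqrt (of_int (-43))"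
    by (simp add: z omega_def of_rat_add of_rat_mult of_rat_divide field_simps)
  then have "z \<in> quadratic_field (-43)"
    unfolding quadratic_field_def by blast
  ultimately show "z \<in> quadratic_integers (-43)"
    by (simp add: quadratic_integers_def)
next
  fix z assume "z \<in> quadratic_integers (-43)"
  then obtain a b where z: "z = of_rat a + of_rat b * csqrt (-43)" and "algebraic_int z"
    by (auto simp: quadratic_integers_def quadratic_field_def)
  show "z \<in> {of_int a + of_int b * omega | a b. True}"
  proof (cases "b = 0")
    case True
    then have "z \<in> \<int>"
      using rational_algebraic_int_is_int[OF \<open>algebraic_int z\<close>] z by simp
    then obtain k where "z = of_int k + of_int 0 * omega" by (auto elim: Ints_cases)
    then show ?thesis by blast
  next
    case False
    obtain p :: "int poly" where p: "poly (map_poly of_int p) z = 0" "lead_coeff p = 1"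
      using \<open>algebraic_int z\<close> algebraic_int_altdef_ipoly by blast
    define q :: "rat poly" where "q = [:a^2 + 43 * b^2, -2*a, 1:]"
    define P where "P = map_poly rat_of_int p"
    define r where "r = P mod q"
    have s: "csqrt (-43) * csqrt (-43) = -43"
      by (metis power2_csqrt power2_eq_square)
    have ev_mult: "poly (map_poly of_rat (f * g)) z = poly (map_poly of_rat f) z * poly (map_poly of_rat g) z"
      for f g
    proof -
      have "map_poly of_rat (f * g) = (map_poly of_rat f * map_poly of_rat g :: complex poly)"
        by (simp add: poly_eq_iff coeff_map_poly coeff_mult of_rat_sum of_rat_mult)
      then show ?thesis by simp
    qed
    have ev_add: "poly (map_poly of_rat (f + g)) z = poly (map_poly of_rat f) z + poly (map_poly of_rat g) z"
      for f g
    proof -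
      have "map_poly of_rat (f + g) = (map_poly of_rat f + map_poly of_rat g :: complex poly)"
        by (simp add: poly_eq_iff coeff_map_poly of_rat_add)
      then show ?thesis by simp
    qed
    have "poly (map_poly of_rat q) z = of_rat b ^ 2 * (csqrt (-43) * csqrt (-43) + 43)"
      unfolding q_def z
      by (simp add: map_poly_pCons of_rat_add of_rat_mult of_rat_minus of_rat_power
          algebra_simps power2_eq_square)
    then have qz: "poly (map_poly of_rat q) z = 0" unfolding s by simp
    have "map_poly of_rat P = (map_poly of_int p :: complex poly)"
      by (simp add: P_def map_poly_map_poly o_def)
    then have "poly (map_poly of_rat P) z = 0" using p by simp
    moreover have "P = q * (P div q) + r" by (simp add: r_def)
    ultimately have rz: "poly (map_poly of_rat r) z = 0"
      using ev_add[of "q * (P div q)" r] by (simp add: ev_mult qz)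
    have "q \<noteq> 0" "degree q = 2" by (simp_all add: q_def)
    then have "r = 0 \<or> degree r < 2"
      using degree_mod_less[of q P] by (auto simp: r_def)
    then have "degree r \<le> 1" by auto
    then have r: "r = [:coeff r 0, coeff r 1:]"
      by (intro poly_eqI) (auto simp: coeff_pCons coeff_eq_0 split: nat.splits)
    define c d where "c = coeff r 0" "d = coeff r 1"
    have "poly (map_poly of_rat [:c, d:]) z = 0"
      using rz r by (simp add: c_d_def)
    then have cd: "of_rat (c + d * a) + of_rat (d * b) * csqrt (-43) = 0"
      by (simp add: z map_poly_pCons of_rat_add of_rat_mult algebra_simps split: if_splits)
    have rat: "(of_rat x :: complex) = of_real (of_rat x)" for x
      by (cases x) (simp add: of_rat_rat)
    have "d * b = 0"
      using arg_cong[OF cd, of Im] unfolding csqrt_43 rat by simp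
    then have "d = 0" using False by simp
    then have "c = 0" using cd by simp
    then have "P = q * (P div q)"
      using r \<open>d = 0\<close> \<open>P = q * (P div q) + r\<close> by (simp add: c_d_def)
    then obtain Q where Q: "q = map_poly rat_of_int Q"
      using monic_factor_int_poly[of p q "P div q"] p(2) unfolding P_def
      by (auto simp: q_def)
    obtain m N where m: "2 * a = of_int m" and N: "a^2 + 43 * b^2 = of_int N"
    proof
      have "-2 * a = of_int (coeff Q 1)"
        using arg_cong[OF Q, of "\<lambda>f. coeff f 1"] by (simp add: q_def coeff_map_poly)
      then show "2 * a = of_int (- coeff Q 1)" by simp
      show "a^2 + 43 * b^2 = of_int (coeff Q 0)"
        using arg_cong[OF Q, of "\<lambda>f. coeff f 0"] by (simp add: q_def coeff_map_poly)
    qed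
    have "(86 * b)^2 = 43 * (4 * (a^2 + 43 * b^2) - (2*a)^2)"
      by (simp add: power2_eq_square algebra_simps)
    then have sq: "(86 * b)^2 = of_int (43 * (4 * N - m^2))"
      by (simp add: m N)
    have "86 * b \<in> \<int>"
    proof (rule rational_algebraic_int_is_int)
      show "algebraic_int (86 * b)"
        using sq
        by (intro algebraic_int.intros[of "[:- of_int (43 * (4 * N - m^2)), 0, 1:]"])
           (auto simp: coeff_pCons power2_eq_square split: nat.splits)
      show "86 * b \<in> \<rat>" by (cases b) (simp add: Rats_def)
    qed
    then obtain e where e: "86 * b = of_int e" by (auto elim: Ints_cases)
    have "e^2 = 43 * (4 * N - m^2)"
      using sq unfolding e by (metis of_int_eq_iff of_int_power)
    moreover have "prime (43::int)" by simp
    ultimately obtain f where f: "e = 43 * f"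
      by (metis dvd_def dvd_triv_left prime_dvd_power)
    have b: "2 * b = of_int f" using e f by simp
    have "43 * f^2 = 4 * N - m^2"
      using \<open>e^2 = _\<close> f by (simp add: power2_eq_square)
    then have "even (43 * f^2 + m^2)" by simp
    then have "even (m - f)" by simp
    then obtain k where "m - f = 2 * k" by (rule evenE)
    then have k: "m = f + 2 * k" by simp
    have ab: "a = of_int k + of_int f / 2" "b = of_int f / 2"
      using m b k by (simp_all add: field_simps)
    have "z = of_int k + of_int f * omega"
      unfolding z ab omega_def by (simp add: of_rat_add of_rat_mult of_rat_divide field_simps)
    then show ?thesis by blast
  qed
qed

lemma
  assumes "x \<in> quadratic_integers (-43)" "y \<in> quadratic_integers (-43)"
  shows quadratic_integers_43_add: "x + y \<in> quadratic_integers (-43)"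
    and quadratic_integers_43_mult: "x * y \<in> quadratic_integers (-43)"
proof -
  obtain a b c d :: int where *: "x = of_int a + of_int b * omega" "y = of_int c + of_int d * omega"
    using assms by (auto simp: quadratic_integers_43)
  have "x + y = of_int (a + c) + of_int (b + d) * omega"
    by (simp add: * algebra_simps)
  moreover have "x * y = of_int (a * c) + of_int (a * d + b * c) * omega
      + of_int (b * d) * (omega * omega)"
    by (simp add: * algebra_simps)
  then have "x * y = of_int (a * c - 11 * b * d) + of_int (a * d + b * c + b * d) * omega"
    by (simp add: omega_square algebra_simps)
  ultimately show "x + y \<in> quadratic_integers (-43)" "x * y \<in> quadratic_integers (-43)"
    unfolding quadratic_integers_43 by blast+
qed

lemma int_in_quadratic_integers_43: "of_int k \<in> quadratic_integers (-43)"
proof -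
  have "of_int k = of_int k + of_int 0 * omega" by simp
  then show ?thesis unfolding quadratic_integers_43 by blast
qed

lemma quadratic_integers_43_minus:
  "x \<in> quadratic_integers (-43) \<Longrightarrow> - x \<in> quadratic_integers (-43)"
  using quadratic_integers_43_mult[OF int_in_quadratic_integers_43[of "-1"], of x] by simp

lemma omega_in_quadratic_integers_43: "omega \<in> quadratic_integers (-43)"
proof -
  have "omega = of_int 0 + of_int 1 * omega" by simp
  then show ?thesis unfolding quadratic_integers_43 by blast
qed

lemma matrix_mult_2_entry:
  "(M ** N) $ i $ j = M $ i $ 1 * N $ 1 $ j + M $ i $ 2 * N $ 2 $ j"
  for M N :: "'a::semiring_1^2^2"
  by (simp add: matrix_matrix_mult_def sum_2)

lemma group_SL2_43: "group (SL2 (quadratic_integers (-43)))"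
proof (rule groupI)
  fix M assume M: "M \<in> carrier (SL2 (quadratic_integers (-43)))"
  define N :: "complex^2^2" where
    "N = vector [vector [M$2$2, - M$1$2], vector [- M$2$1, M$1$1]]"
  have "N \<in> carrier (SL2 (quadratic_integers (-43)))"
    using M by (auto simp: SL2_def N_def det_2 forall_2 algebra_simps
        intro: quadratic_integers_43_minus)
  moreover have "N ** M = mat 1"
    using M by (simp add: SL2_def N_def det_2 vec_eq_iff forall_2 matrix_matrix_mult_def
        sum_2 mat_def algebra_simps)
  ultimately show "\<exists>N\<in>carrier (SL2 (quadratic_integers (-43))).
      N \<otimes>\<^bsub>SL2 (quadratic_integers (-43))\<^esub> M = \<one>\<^bsub>SL2 (quadratic_integers (-43))\<^esub>"
    by (intro bexI[of _ N]) (simp_all add: SL2_def)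
next
  show "\<one>\<^bsub>SL2 (quadratic_integers (-43))\<^esub> \<in> carrier (SL2 (quadratic_integers (-43)))"
    using int_in_quadratic_integers_43[of 0] int_in_quadratic_integers_43[of 1]
    by (simp add: SL2_def mat_def det_2)
qed (auto simp: SL2_def det_mul matrix_mul_assoc matrix_mult_2_entry
    intro!: quadratic_integers_43_add quadratic_integers_43_mult)

lemma normal_center_SL2_43: "{mat 1, - mat 1} \<lhd> SL2 (quadratic_integers (-43))"
proof -
  interpret group "SL2 (quadratic_integers (-43))" by (rule group_SL2_43)
  let ?G = "SL2 (quadratic_integers (-43))"
  have one: "mat 1 \<in> carrier ?G" using one_closed by (simp add: SL2_def)
  have minus: "- M \<in> carrier ?G" if "M \<in> carrier ?G" for M
    using that by (auto simp: SL2_def det_2 intro: quadratic_integers_43_minus)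
  have mult: "M \<otimes>\<^bsub>?G\<^esub> - mat 1 = - M" "- mat 1 \<otimes>\<^bsub>?G\<^esub> M = - M" for M
    by (simp_all add: SL2_def vec_eq_iff matrix_matrix_mult_def sum_2 forall_2 mat_def)
  have mult1: "M \<otimes>\<^bsub>?G\<^esub> mat 1 = M" "mat 1 \<otimes>\<^bsub>?G\<^esub> M = M" for M
    by (simp_all add: SL2_def)
  have "inv\<^bsub>?G\<^esub> (- mat 1) = - mat 1"
    using one minus mult by (intro inv_equality) (auto simp: SL2_def[of "quadratic_integers _"])
  moreover have "inv\<^bsub>?G\<^esub> (mat 1) = mat 1"
    using one mult1 by (intro inv_equality) (auto simp: SL2_def[of "quadratic_integers _"])
  ultimately have "subgroup {mat 1, - mat 1} ?G"
    using one minus mult mult1 by (intro subgroupI) auto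
  moreover have "x \<otimes>\<^bsub>?G\<^esub> h \<otimes>\<^bsub>?G\<^esub> inv\<^bsub>?G\<^esub> x \<in> {mat 1, - mat 1}"
    if "x \<in> carrier ?G" "h \<in> {mat 1, - mat 1}" for x h
  proof -
    have "x \<otimes>\<^bsub>?G\<^esub> h = h \<otimes>\<^bsub>?G\<^esub> x" using that mult mult1 by auto
    moreover have "h \<in> carrier ?G" using that one minus by auto
    ultimately show ?thesis using that by (simp add: m_assoc)
  qed
  ultimately show ?thesis by (auto simp: normal_inv_iff)
qed

datatype bianchi_gen = gA | gB | gU | gR | gS

primrec gen_matrix :: "bianchi_gen \<Rightarrow> complex^2^2" where
  "gen_matrix gA = vector [vector [1, 1], vector [0, 1]]"
| "gen_matrix gB = vector [vector [0, 1], vector [-1, 0]]"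
| "gen_matrix gU = vector [vector [1, omega], vector [0, 1]]"
| "gen_matrix gR = vector [vector [1 + omega, omega - 6], vector [2, omega]]"
| "gen_matrix gS = vector [vector [3, omega], vector [1 - omega, 4]]"

definition word_power :: "'g letter list \<Rightarrow> nat \<Rightarrow> 'g letter list" where
  "word_power w n = concat (replicate n w)"

definition bianchi_relators :: "bianchi_gen letter list set" where
  "bianchi_relators =
    (let A = Gen gA; A' = Inv gA; B = Gen gB; U = Gen gU; U' = Inv gU;
         R = Gen gR; R' = Inv gR; S = Gen gS; S' = Inv gS
     in {word_power [B] 2,
         word_power [B, A] 3,
         [A, U, A', U'],
         word_power [R', U] 3,
         [A', R, A', U', R, A', R', U, R'],
         [A', R, U', S, R', U, B, S', B],
         word_power [U, A, S', B, S, R'] 2,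
         word_power [B, S, U', R, S', A] 2,
         [A', U', S, R', U, S', B, A', S, R', U, S', B, U],
         [U, B, U', A', R, S', B, S, A', B, S', B, U, R', A, S, R']})"

lemma gen_matrix_in_SL2: "gen_matrix x \<in> carrier (SL2 (quadratic_integers (-43)))"
proof -
  have sub: "y - z \<in> quadratic_integers (-43)"
    if "y \<in> quadratic_integers (-43)" "z \<in> quadratic_integers (-43)" for y z
    using quadratic_integers_43_add[OF that(1) quadratic_integers_43_minus[OF that(2)]]
    by simp
  note ints = int_in_quadratic_integers_43[of 0] int_in_quadratic_integers_43[of 1]
    int_in_quadratic_integers_43[of "-1"] int_in_quadratic_integers_43[of 2]
    int_in_quadratic_integers_43[of 3] int_in_quadratic_integers_43[of 4]
    int_in_quadratic_integers_43[of 6]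
  show ?thesis
    using ints[simplified] omega_in_quadratic_integers_43
    by (cases x) (auto simp: SL2_def det_2 forall_2 algebra_simps omega_square
        intro!: quadratic_integers_43_add sub)
qed

end

theory Submission
  imports Defs
begin

unbundle no fps_syntax

text \<open>Reduction theory of the cusps. Let \<open>(c, d)\<close> be the bottom row of the matrix of a word \<open>w\<close>, and call
  \<open>|c|\<^sup>2\<close> the height of \<open>w\<close>. Multiplying by a word \<open>f\<close> with \<open>f\<infinity> = r/s\<close> lowers the height iff \<open>z = -d/c\<close>
  lies in the open disc of radius \<open>1/|s|\<close> around \<open>r/s\<close>. Modulo translations there are nine discs that
  bound the Ford domain; their centres \<open>(k + l\<omega>)/s\<close> have \<open>s \<in> {1, 2, 3}\<close>, lie on horizontal lines, and the
  discs cover the plane. Neighbouring discs correspond to the edges of the Ford domain, and each edge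
  gives a relation saying that two ways to descend agree modulo the relators. Since the discs that
  contain a given point \<open>z\<close> are connected through neighbours, the element of the presented group obtained
  by descending from \<open>w\<close> to height \<open>0\<close>, where only translations are left, depends on the matrix of \<open>w\<close>
  alone. Hence a word with trivial matrix is trivial modulo the relators, and descending from an
  arbitrary matrix shows that the generators generate.\<close>

section \<open>Words modulo relators\<close>

text \<open>Equality of matrices says nothing yet about words: a word whose matrix fixes \<infinity>
  is known to equal a translation modulo the relators only once a descent of that very word is
  exhibited. \<open>descending\<close> asserts that a descent exists, so it has to be shown for
  every word. Appending a letter is a translation or at most two moves, so it suffices that
  \<open>descending\<close> passes along each move, whatever the move does to the height. The same
  closure lets two words with one matrix be compared along a common descent. The delicate case is a
  tie: if z lies on a bounding circle, the move keeps the height, and a disc with z in its interior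
  has to be reached first. This is why edges must work on closed discs. Unit discs alone cannot
  cover the plane, since their lines of centres are \<surd>43/2, about 3.28, apart. Rows of radius
  1/3, 1/2 and 1/3 at one third, one half and two thirds of that distance close the gap. As 2 and 3
  are inert in the ring, (k + l\<omega>)/s with l prime to s is automatically in lowest
  terms.\<close>

definition winv :: "'g letter list \<Rightarrow> 'g letter list" where
  "winv w = rev (map inv_letter w)"

lemma winv_simps [simp]:
  "winv [] = []" "winv (x # w) = winv w @ [inv_letter x]" "winv (u @ v) = winv v @ winv u"
  by (simp_all add: winv_def)

lemma winv_winv [simp]: "winv (winv w) = w"
  by (induction w) auto

lemma reduce_append: "reduce (u @ v) = foldr push u (reduce v)"
  by (simp add: reduce_def)

lemma reduce_append_reduce: "reduce (reduce u @ reduce v) = reduce (u @ v)"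
  by (simp add: reduce_append foldr_push_reduce reduce_freely_reduced)

lemma reduce_append_winv [simp]: "reduce (winv w @ w) = []" "reduce (w @ winv w) = []"
proof -
  have *: "reduce (winv w @ w) = []" for w :: "'g letter list"
    using foldr_push_inverse[of "[]" w] by (simp add: reduce_def winv_def)
  show "reduce (winv w @ w) = []" by (rule *)
  show "reduce (w @ winv w) = []" using *[of "winv w"] by simp
qed

definition word_class :: "'g letter list set \<Rightarrow> 'g letter list \<Rightarrow> 'g letter list set" where
  "word_class Rels w = relator_closure Rels #>\<^bsub>free_group\<^esub> reduce w"

definition word_eq :: "'g letter list set \<Rightarrow> 'g letter list \<Rightarrow> 'g letter list \<Rightarrow> bool" where
  "word_eq Rels u v \<longleftrightarrow> word_class Rels u = word_class Rels v"

lemma reduce_in_free_group [simp]: "reduce w \<in> carrier free_group"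
  by (simp add: free_group_def)

lemma mult_free_group: "reduce u \<otimes>\<^bsub>free_group\<^esub> reduce v = reduce (u @ v)"
  by (simp add: free_group_def reduce_append_reduce)

lemma normal_relator_closure: "relator_closure Rels \<lhd> free_group"
  unfolding relator_closure_def by (rule group.normal_normal_closure[OF group_free_group]) auto

lemma word_class_append:
  "word_class Rels (u @ v) = word_class Rels u <#>\<^bsub>free_group\<^esub> word_class Rels v"
  using normal.rcos_sum[OF normal_relator_closure[of Rels], of "reduce u" "reduce v"]
  by (simp add: word_class_def mult_free_group)

lemma word_eq_refl [simp, intro!]: "word_eq Rels w w"
  by (simp add: word_eq_def)

lemma word_eq_sym: "word_eq Rels u v \<Longrightarrow> word_eq Rels v u"
  by (simp add: word_eq_def)

lemma word_eq_trans [trans]: "word_eq Rels u v \<Longrightarrow> word_eq Rels v w \<Longrightarrow> word_eq Rels u w"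
  by (simp add: word_eq_def)

lemma word_eq_append: "word_eq Rels u u' \<Longrightarrow> word_eq Rels v v' \<Longrightarrow> word_eq Rels (u @ v) (u' @ v')"
  by (simp add: word_eq_def word_class_append)

lemma word_eq_reduce: "reduce u = reduce v \<Longrightarrow> word_eq Rels u v"
  by (simp add: word_eq_def word_class_def)

lemma word_eq_Nil_iff: "word_eq Rels w [] \<longleftrightarrow> reduce w \<in> relator_closure Rels"
proof -
  interpret N: normal "relator_closure Rels" free_group by (rule normal_relator_closure)
  have one: "reduce [] = \<one>\<^bsub>free_group\<^esub>"
    by (simp add: free_group_def reduce_def)
  have join: "word_class Rels v = relator_closure Rels \<longleftrightarrow> reduce v \<in> relator_closure Rels" for v
  proof
    assume "word_class Rels v = relator_closure Rels"
    then show "reduce v \<in> relator_closure Rels"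
      unfolding word_class_def
      by (rule N.coset_join1[OF _ reduce_in_free_group N.subgroup_axioms])
  next
    assume "reduce v \<in> relator_closure Rels"
    then show "word_class Rels v = relator_closure Rels"
      unfolding word_class_def
      by (rule N.coset_join2[OF reduce_in_free_group N.subgroup_axioms])
  qed
  have "word_class Rels [] = relator_closure Rels"
    unfolding join one by (rule subgroup.one_closed[OF N.subgroup_axioms])
  then show ?thesis
    unfolding word_eq_def join[symmetric] by simp
qed

lemma word_eq_relator: "r \<in> Rels \<Longrightarrow> word_eq Rels r []"
  by (auto simp: word_eq_Nil_iff relator_closure_def normal_closure_def)

lemma word_eq_winv_Nil:
  assumes "word_eq Rels w []"
  shows "word_eq Rels (winv w) []"
proof -
  have "word_eq Rels (winv w) (winv w @ w)"
    using word_eq_append[OF word_eq_refl word_eq_sym[OF assms], of "winv w"] by simp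
  also have "word_eq Rels \<dots> []"
    by (rule word_eq_reduce) (simp add: reduce_def[of "[]"])
  finally show ?thesis .
qed

lemma word_eq_cancel_right:
  assumes "word_eq Rels (u @ w) (v @ w)"
  shows "word_eq Rels u v"
proof -
  have *: "word_eq Rels (x @ w @ winv w) x" for x
    using word_eq_append[OF word_eq_refl word_eq_reduce, of "w @ winv w" "[]" Rels x]
    by (simp add: reduce_def[of "[]"])
  have "word_eq Rels u ((u @ w) @ winv w)" using word_eq_sym[OF *[of u]] by simp
  also have "word_eq Rels \<dots> ((v @ w) @ winv w)" by (intro word_eq_append assms word_eq_refl)
  also have "word_eq Rels \<dots> v" using *[of v] by simp
  finally show ?thesis .
qed

lemma word_eq_move_right:
  assumes "word_eq Rels (u @ w) v"
  shows "word_eq Rels u (v @ winv w)"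
proof (rule word_eq_cancel_right)
  note assms
  also have "word_eq Rels v (v @ winv w @ w)"
    using word_eq_append[OF word_eq_refl word_eq_reduce, of "[]" "winv w @ w" Rels v]
    by (simp add: reduce_def[of "[]"])
  finally show "word_eq Rels (u @ w) ((v @ winv w) @ w)" by simp
qed

text \<open>A certificate that \<open>v\<close> and \<open>w\<close> agree modulo relators: the triple \<open>(u, r, True)\<close> stands for
  the conjugate of \<open>r\<close> by \<open>u\<close>, and \<open>(u, r, False)\<close> for the inverse of that conjugate.\<close>

fun conj_prod :: "('g letter list \<times> 'g letter list \<times> bool) list \<Rightarrow> 'g letter list" where
  "conj_prod [] = []"
| "conj_prod ((u, r, s) # cs) = u @ (if s then r else winv r) @ winv u @ conj_prod cs"

text \<open>Conjugates of trivial words are trivial, so a relation comes down to the free reduction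
  of a concrete word, which simplification evaluates. The words \<open>r\<close> need only be
  trivial, not relators, so relations proved in this way can enter later certificates.\<close>

lemma word_eq_conj_prod:
  assumes "\<forall>(u, r, s) \<in> set cs. word_eq Rels r []" "reduce v = reduce (conj_prod cs @ w)"
  shows "word_eq Rels v w"
proof -
  have "word_eq Rels (conj_prod cs) []"
    using assms(1)
  proof (induction cs rule: conj_prod.induct)
    case (2 u r s cs)
    have "word_eq Rels (if s then r else winv r) []"
      using 2 by (auto intro: word_eq_winv_Nil)
    then have "word_eq Rels (u @ (if s then r else winv r) @ winv u @ conj_prod cs) (u @ [] @ winv u @ [])"
      using 2 by (intro word_eq_append word_eq_refl) auto
    also have "word_eq Rels \<dots> []"
      by (rule word_eq_reduce) (simp add: reduce_def[of "[]"])
    finally show ?case by simp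
  qed simp
  then have "word_eq Rels (conj_prod cs @ w) ([] @ w)"
    by (intro word_eq_append word_eq_refl)
  then show ?thesis
    using word_eq_trans[OF word_eq_reduce[OF assms(2)]] by simp
qed

section \<open>Evaluating words in a group\<close>

fun letter_value :: "('a, 'b) monoid_scheme \<Rightarrow> ('g \<Rightarrow> 'a) \<Rightarrow> 'g letter \<Rightarrow> 'a" where
  "letter_value G f (Gen x) = f x"
| "letter_value G f (Inv x) = inv\<^bsub>G\<^esub> f x"

definition word_value :: "('a, 'b) monoid_scheme \<Rightarrow> ('g \<Rightarrow> 'a) \<Rightarrow> 'g letter list \<Rightarrow> 'a" where
  "word_value G f w = foldr (\<lambda>x g. letter_value G f x \<otimes>\<^bsub>G\<^esub> g) w \<one>\<^bsub>G\<^esub>"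

lemma word_value_simps [simp]:
  "word_value G f [] = \<one>\<^bsub>G\<^esub>"
  "word_value G f (x # w) = letter_value G f x \<otimes>\<^bsub>G\<^esub> word_value G f w"
  by (simp_all add: word_value_def)

context group
begin

lemma letter_value_closed: "\<forall>x. f x \<in> carrier G \<Longrightarrow> letter_value G f x \<in> carrier G"
  by (cases x) auto

lemma word_value_closed: "\<forall>x. f x \<in> carrier G \<Longrightarrow> word_value G f w \<in> carrier G"
  by (induction w) (auto intro: letter_value_closed)

lemma word_value_append:
  "\<forall>x. f x \<in> carrier G \<Longrightarrow> word_value G f (u @ v) = word_value G f u \<otimes> word_value G f v"
  by (induction u) (auto simp: m_assoc letter_value_closed word_value_closed)

lemma letter_value_inv_letter:
  "\<forall>x. f x \<in> carrier G \<Longrightarrow> letter_value G f (inv_letter x) = inv (letter_value G f x)"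
  by (cases x) auto

lemma word_value_winv: "\<forall>x. f x \<in> carrier G \<Longrightarrow> word_value G f (winv w) = inv (word_value G f w)"
  by (induction w)
    (auto simp: word_value_append letter_value_inv_letter letter_value_closed word_value_closed
      inv_mult_group)

lemma word_value_push:
  assumes "\<forall>x. f x \<in> carrier G"
  shows "word_value G f (push x w) = letter_value G f x \<otimes> word_value G f w"
proof (cases w)
  case (Cons y v)
  have "letter_value G f x \<otimes> (inv (letter_value G f x) \<otimes> word_value G f v) = word_value G f v"
    using assms by (simp add: letter_value_closed word_value_closed flip: m_assoc)
  then show ?thesis
    using Cons assms by (simp add: letter_value_inv_letter)
qed simp

lemma word_value_reduce: "\<forall>x. f x \<in> carrier G \<Longrightarrow> word_value G f (reduce w) = word_value G f w"
  by (induction w) (auto simp: reduce_def word_value_push)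

lemma word_value_hom_free_group:
  assumes f: "\<forall>x. f x \<in> carrier G"
  shows "group_hom free_group G (word_value G f)"
proof -
  interpret F: group free_group by (rule group_free_group)
  have "word_value G f \<in> hom free_group G"
  proof (rule homI)
    fix u v
    show "word_value G f (u \<otimes>\<^bsub>free_group\<^esub> v) = word_value G f u \<otimes> word_value G f v"
      by (simp add: free_group_def word_value_reduce word_value_append f)
  qed (simp add: word_value_closed f)
  then show ?thesis by unfold_locales
qed

lemma relator_closure_subset_kernel:
  assumes "\<forall>x. f x \<in> carrier G" "\<And>r. r \<in> Rels \<Longrightarrow> word_value G f r = \<one>"
  shows "relator_closure Rels \<subseteq> kernel free_group G (word_value G f)"
proof -
  interpret h: group_hom free_group G "word_value G f"
    by (rule word_value_hom_free_group[OF assms(1)])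
  have "reduce ` Rels \<subseteq> kernel free_group G (word_value G f)"
    using assms by (auto simp: kernel_def word_value_reduce)
  then show ?thesis
    using h.normal_kernel by (auto simp: relator_closure_def normal_closure_def)
qed

lemma word_value_word_eq:
  assumes f: "\<forall>x. f x \<in> carrier G" and "\<And>r. r \<in> Rels \<Longrightarrow> word_value G f r = \<one>"
    and "word_eq Rels u v"
  shows "word_value G f u = word_value G f v"
proof -
  interpret h: group_hom free_group G "word_value G f"
    by (rule word_value_hom_free_group[OF f])
  interpret N: normal "relator_closure Rels" free_group by (rule normal_relator_closure)
  have "reduce u \<in> word_class Rels v"
    using assms(3) h.G.rcos_self[OF reduce_in_free_group N.subgroup_axioms, of u]
    by (simp add: word_eq_def word_class_def)
  then obtain k where k: "k \<in> relator_closure Rels" "reduce u = k \<otimes>\<^bsub>free_group\<^esub> reduce v"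
    unfolding word_class_def r_coset_def by blast
  then have "k \<in> carrier free_group" "word_value G f k = \<one>"
    using relator_closure_subset_kernel[OF assms(1,2)] by (auto simp: kernel_def)
  then have "word_value G f (reduce u) = word_value G f (reduce v)"
    unfolding k(2) by (simp add: word_value_closed f)
  then show ?thesis by (simp add: word_value_reduce f)
qed

text \<open>Together \<open>rels\<close> and \<open>inj\<close> identify the kernel of evaluation on
  the free group with the normal closure of the relators; the first isomorphism theorem then yields
  the required map.\<close>

lemma has_presentationI:
  assumes f: "\<forall>x. f x \<in> carrier G"
    and rels: "\<And>r. r \<in> Rels \<Longrightarrow> word_value G f r = \<one>"
    and inj: "\<And>w. word_value G f w = \<one> \<Longrightarrow> word_eq Rels w []"
    and surj: "\<And>g. g \<in> carrier G \<Longrightarrow> \<exists>w. word_value G f w = g"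
  shows "has_presentation G Rels f"
proof -
  let ?h = "word_value G f"
  interpret h: group_hom free_group G ?h by (rule word_value_hom_free_group[OF f])
  have K: "kernel free_group G ?h = relator_closure Rels"
  proof
    show "kernel free_group G ?h \<subseteq> relator_closure Rels"
    proof
      fix w assume "w \<in> kernel free_group G ?h"
      then have "freely_reduced w" "?h w = \<one>" by (auto simp: kernel_def free_group_def)
      then show "w \<in> relator_closure Rels"
        using inj[of w] by (simp add: word_eq_Nil_iff reduce_freely_reduced)
    qed
    show "relator_closure Rels \<subseteq> kernel free_group G ?h"
      by (rule relator_closure_subset_kernel[OF f rels])
  qed
  have "?h ` carrier free_group = carrier G"
  proof (intro equalityI subsetI)
    fix g assume "g \<in> carrier G"
    then obtain w where "?h w = g" using surj by blast
    then have "?h (reduce w) = g" by (simp add: word_value_reduce f)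
    then show "g \<in> ?h ` carrier free_group" by force
  qed (auto simp: word_value_closed f)
  then have iso: "(\<lambda>X. the_elem (?h ` X)) \<in> iso (presented_group Rels) G"
    using h.FactGroup_iso_set by (simp add: presented_group_def K)
  have "the_elem (?h ` presented_gen Rels x) = f x" for x
  proof -
    have "[Gen x] \<in> carrier free_group" by (simp add: free_group_def)
    then have mem: "[Gen x] \<in> presented_gen Rels x"
      unfolding presented_gen_def K[symmetric]
      by (intro h.G.rcos_self h.subgroup_kernel)
    have "?h w = f x" if "w \<in> presented_gen Rels x" for w
    proof -
      obtain k where "k \<in> kernel free_group G ?h" "w = k \<otimes>\<^bsub>free_group\<^esub> [Gen x]"
        using \<open>w \<in> presented_gen Rels x\<close> unfolding presented_gen_def K[symmetric] r_coset_def by blast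
      then show ?thesis
        using \<open>[Gen x] \<in> carrier free_group\<close> f by (simp add: kernel_def h.hom_mult)
    qed
    moreover have "?h ` presented_gen Rels x \<noteq> {}" using mem by blast
    ultimately have "?h ` presented_gen Rels x = {f x}" by (intro equalityI subsetI) auto
    then show ?thesis by simp
  qed
  then show ?thesis
    unfolding has_presentation_def by (intro bexI[OF _ iso]) simp
qed

end

lemma (in group_hom) word_value_hom:
  assumes "\<forall>x. f x \<in> carrier G"
  shows "word_value H (\<lambda>x. h (f x)) w = h (word_value G f w)"
proof (induction w)
  case (Cons x w)
  have "letter_value H (\<lambda>x. h (f x)) x = h (letter_value G f x)"
    using assms by (cases x) auto
  then show ?case
    using Cons assms by (simp add: G.letter_value_closed G.word_value_closed)
qed simp

section \<open>Words in the generators as matrices\<close>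

abbreviation "O43 \<equiv> quadratic_integers (-43)"

abbreviation "A \<equiv> Gen gA"
abbreviation "A' \<equiv> Inv gA"
abbreviation "B \<equiv> Gen gB"
abbreviation "B' \<equiv> Inv gB"
abbreviation "U \<equiv> Gen gU"
abbreviation "U' \<equiv> Inv gU"
abbreviation "R \<equiv> Gen gR"
abbreviation "R' \<equiv> Inv gR"
abbreviation "S \<equiv> Gen gS"
abbreviation "S' \<equiv> Inv gS"

abbreviation weq (infix "\<doteq>" 50) where
  "u \<doteq> v \<equiv> word_eq bianchi_relators u v"

abbreviation word_matrix :: "bianchi_gen letter list \<Rightarrow> complex^2^2" where
  "word_matrix \<equiv> word_value (SL2 O43) gen_matrix"

definition zom :: "int \<Rightarrow> int \<Rightarrow> complex" where
  "zom a b = of_int a + of_int b * omega"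

lemma O43_cases:
  assumes "z \<in> O43"
  obtains a b where "z = zom a b"
  using assms unfolding zom_def quadratic_integers_43 by blast

text \<open>A column \<open>(a + b\<omega>, c + d\<omega>)\<close> is represented by the integers \<open>(a, b, c, d)\<close>.\<close>

fun letter_col :: "bianchi_gen letter \<Rightarrow> int \<times> int \<times> int \<times> int \<Rightarrow> int \<times> int \<times> int \<times> int" where
  "letter_col (Gen gA) (a, b, c, d) = (a + c, b + d, c, d)"
| "letter_col (Inv gA) (a, b, c, d) = (a - c, b - d, c, d)"
| "letter_col (Gen gB) (a, b, c, d) = (c, d, - a, - b)"
| "letter_col (Inv gB) (a, b, c, d) = (- c, - d, a, b)"
| "letter_col (Gen gU) (a, b, c, d) = (a - 11 * d, b + c + d, c, d)"
| "letter_col (Inv gU) (a, b, c, d) = (a + 11 * d, b - c - d, c, d)"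
| "letter_col (Gen gR) (a, b, c, d) =
    (a - 11 * b - 6 * c - 11 * d, a + 2 * b + c - 5 * d, 2 * a - 11 * d, 2 * b + c + d)"
| "letter_col (Inv gR) (a, b, c, d) =
    (- 11 * b + 6 * c + 11 * d, a + b - c + 5 * d, - 2 * a + c - 11 * d, - 2 * b + c + 2 * d)"
| "letter_col (Gen gS) (a, b, c, d) =
    (3 * a - 11 * d, 3 * b + c + d, a + 11 * b + 4 * c, - a + 4 * d)"
| "letter_col (Inv gS) (a, b, c, d) =
    (4 * a + 11 * d, 4 * b - c - d, - a - 11 * b + 3 * c, a + 3 * d)"

definition word_col :: "bianchi_gen letter list \<Rightarrow> int \<times> int \<times> int \<times> int \<Rightarrow> int \<times> int \<times> int \<times> int" where
  "word_col w = foldr letter_col w"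

lemma word_col_simps [simp]:
  "word_col [] v = v" "word_col (x # w) v = letter_col x (word_col w v)"
  by (simp_all add: word_col_def)

lemma word_col_append [simp]: "word_col (u @ v) x = word_col u (word_col v x)"
  by (induction u) auto

lemma mult_SL2 [simp]: "M \<otimes>\<^bsub>SL2 \<O>\<^esub> N = M ** N" "\<one>\<^bsub>SL2 \<O>\<^esub> = mat 1"
  by (simp_all add: SL2_def)

lemma letter_matrix_inv:
  assumes "gen_matrix x = vector [vector [p, q], vector [r, s]]"
  shows "letter_value (SL2 O43) gen_matrix (Inv x) = vector [vector [s, - q], vector [- r, p]]"
proof -
  interpret group "SL2 O43" by (rule group_SL2_43)
  let ?N = "vector [vector [s, - q], vector [- r, p]] :: complex^2^2"
  have G: "gen_matrix x \<in> carrier (SL2 O43)" by (rule gen_matrix_in_SL2)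
  then have det: "p * s - q * r = 1" and ent: "p \<in> O43" "q \<in> O43" "r \<in> O43" "s \<in> O43"
    by (auto simp: SL2_def assms det_2 forall_2)
  have N: "?N \<in> carrier (SL2 O43)"
    using det ent by (auto simp: SL2_def det_2 forall_2 algebra_simps intro: quadratic_integers_43_minus)
  have "?N ** gen_matrix x = mat 1"
    using det by (simp add: assms vec_eq_iff forall_2 matrix_matrix_mult_def sum_2 mat_def algebra_simps)
  then show ?thesis
    using inv_equality[of ?N "gen_matrix x"] G N by simp
qed

lemma letter_matrix_simps:
  "letter_value (SL2 O43) gen_matrix A' = vector [vector [1, -1], vector [0, 1]]"
  "letter_value (SL2 O43) gen_matrix B' = vector [vector [0, -1], vector [1, 0]]"
  "letter_value (SL2 O43) gen_matrix U' = vector [vector [1, -omega], vector [0, 1]]"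
  "letter_value (SL2 O43) gen_matrix R' = vector [vector [omega, 6 - omega], vector [-2, 1 + omega]]"
  "letter_value (SL2 O43) gen_matrix S' = vector [vector [4, -omega], vector [omega - 1, 3]]"
  by (simp_all add: gen_matrix.simps[THEN letter_matrix_inv] del: letter_value.simps)

lemma omega_square_left: "omega * (omega * z) = (omega - 11) * z"
  by (simp add: omega_square flip: mult.assoc)

lemma letter_col_correct:
  assumes "letter_col x (a, b, c, d) = (a', b', c', d')"
  shows "letter_value (SL2 O43) gen_matrix x $ 1 $ 1 * zom a b
      + letter_value (SL2 O43) gen_matrix x $ 1 $ 2 * zom c d = zom a' b'"
    and "letter_value (SL2 O43) gen_matrix x $ 2 $ 1 * zom a b
      + letter_value (SL2 O43) gen_matrix x $ 2 $ 2 * zom c d = zom c' d'"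
proof -
  obtain g where x: "x = Gen g \<or> x = Inv g" by (cases x) auto
  from x assms show "letter_value (SL2 O43) gen_matrix x $ 1 $ 1 * zom a b
      + letter_value (SL2 O43) gen_matrix x $ 1 $ 2 * zom c d = zom a' b'"
    by (cases g;
        auto simp: letter_matrix_simps zom_def simp del: letter_value.simps(2);
        simp add: algebra_simps omega_square omega_square_left)
  from x assms show "letter_value (SL2 O43) gen_matrix x $ 2 $ 1 * zom a b
      + letter_value (SL2 O43) gen_matrix x $ 2 $ 2 * zom c d = zom c' d'"
    by (cases g;
        auto simp: letter_matrix_simps zom_def simp del: letter_value.simps(2);
        simp add: algebra_simps omega_square omega_square_left)
qed

text \<open>Turns matrices of concrete words into integer arithmetic; the starting vector is the
  \<open>j\<close>-th unit column.\<close>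

lemma word_col_correct:
  assumes "word_col w (of_bool (j = 1), 0, of_bool (j = 2), 0) = (a, b, c, d)"
  shows "word_matrix w $ 1 $ j = zom a b \<and> word_matrix w $ 2 $ j = zom c d"
  using assms
proof (induction w arbitrary: a b c d)
  case Nil
  then show ?case using exhaust_2[of j] by (auto simp: zom_def mat_def)
next
  case (Cons x w)
  obtain a0 b0 c0 d0 where *: "word_col w (of_bool (j = 1), 0, of_bool (j = 2), 0) = (a0, b0, c0, d0)"
    by (metis prod_cases4)
  with Cons.prems have "letter_col x (a0, b0, c0, d0) = (a, b, c, d)" by simp
  with letter_col_correct[OF this] Cons.IH[OF *] show ?case
    by (simp add: matrix_mult_2_entry)
qed

lemma word_matrix_closed: "word_matrix w \<in> carrier (SL2 O43)"
  by (simp add: group.word_value_closed[OF group_SL2_43] gen_matrix_in_SL2)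

lemma word_matrix_append: "word_matrix (u @ v) = word_matrix u ** word_matrix v"
  by (simp add: group.word_value_append[OF group_SL2_43] gen_matrix_in_SL2)

lemma word_matrix_entry_in_O43: "word_matrix w $ i $ j \<in> O43"
  using word_matrix_closed[of w] by (simp add: SL2_def)

lemma word_matrix_eqI:
  assumes "word_col w (1, 0, 0, 0) = (a, b, c, d)" "word_col w (0, 0, 1, 0) = (a', b', c', d')"
  shows "word_matrix w = vector [vector [zom a b, zom a' b'], vector [zom c d, zom c' d']]"
  using word_col_correct[of w 1 a b c d] word_col_correct[of w 2 a' b' c' d'] assms
  by (simp add: vec_eq_iff forall_2)

lemma zom_simps [simp]: "zom 0 0 = 0" "zom 1 0 = 1" "zom (-1) 0 = -1"
  by (simp_all add: zom_def)

lemma mat_2: "(mat x :: complex^2^2) = vector [vector [x, 0], vector [0, x]]"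
  by (simp add: vec_eq_iff forall_2 mat_def)

lemma uminus_mat_2: "- (mat x :: complex^2^2) = vector [vector [- x, 0], vector [0, - x]]"
  by (simp add: vec_eq_iff forall_2 mat_def)

text \<open>The sign -1 does occur, already for the square of \<open>B\<close>; matrices of
  equivalent words are therefore compared only up to sign.\<close>

lemma word_matrix_relator:
  assumes "r \<in> bianchi_relators"
  shows "word_matrix r = mat 1 \<or> word_matrix r = - mat 1"
proof -
  have "word_col r (1, 0, 0, 0) = (1, 0, 0, 0) \<and> word_col r (0, 0, 1, 0) = (0, 0, 1, 0)
      \<or> word_col r (1, 0, 0, 0) = (- 1, 0, 0, 0) \<and> word_col r (0, 0, 1, 0) = (0, 0, - 1, 0)"
    using assms by (auto simp: bianchi_relators_def Let_def word_power_def numeral_eq_Suc)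
  then show ?thesis
    using word_matrix_eqI[of r 1 0 0 0 0 0 1 0] word_matrix_eqI[of r "-1" 0 0 0 0 0 "-1" 0]
    unfolding uminus_mat_2 unfolding mat_2 by auto
qed

lemma PSL2_43:
  shows group_PSL2_43: "group (PSL2 O43)"
    and PSL2_class_hom: "PSL2_class O43 \<in> hom (SL2 O43) (PSL2 O43)"
    and PSL2_class_eq_iff: "M \<in> carrier (SL2 O43) \<Longrightarrow> N \<in> carrier (SL2 O43) \<Longrightarrow>
      PSL2_class O43 M = PSL2_class O43 N \<longleftrightarrow> M = N \<or> M = - N"
proof -
  interpret Z: normal "{mat 1, - mat 1}" "SL2 O43" by (rule normal_center_SL2_43)
  show "group (PSL2 O43)" unfolding PSL2_def by (rule Z.factorgroup_is_group)
  show "PSL2_class O43 \<in> hom (SL2 O43) (PSL2 O43)"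
    using Z.r_coset_hom_Mod unfolding PSL2_def PSL2_class_def[abs_def] .
  have cl: "PSL2_class O43 M = {M, - M}" for M
    by (auto simp: PSL2_class_def r_coset_def matrix_mul_lid vec_eq_iff matrix_matrix_mult_def mat_def
        sum_2 forall_2)
  show "PSL2_class O43 M = PSL2_class O43 N \<longleftrightarrow> M = N \<or> M = - N"
    by (auto simp: cl doubleton_eq_iff)
qed

lemma carrier_PSL2: "carrier (PSL2 O43) = PSL2_class O43 ` carrier (SL2 O43)"
  by (auto simp: PSL2_def PSL2_class_def FactGroup_def RCOSETS_def)

lemma word_value_PSL2:
  "word_value (PSL2 O43) (\<lambda>x. PSL2_class O43 (gen_matrix x)) w = PSL2_class O43 (word_matrix w)"
proof -
  interpret group_hom "SL2 O43" "PSL2 O43" "PSL2_class O43"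
    using group_SL2_43 group_PSL2_43 PSL2_class_hom by (simp add: group_hom_def group_hom_axioms_def)
  show ?thesis by (rule word_value_hom) (simp add: gen_matrix_in_SL2)
qed

lemma PSL2_class_in_carrier: "M \<in> carrier (SL2 O43) \<Longrightarrow> PSL2_class O43 M \<in> carrier (PSL2 O43)"
  by (simp add: carrier_PSL2)

lemma relator_value_PSL2:
  assumes "r \<in> bianchi_relators"
  shows "word_value (PSL2 O43) (\<lambda>x. PSL2_class O43 (gen_matrix x)) r = \<one>\<^bsub>PSL2 O43\<^esub>"
proof -
  have "\<one>\<^bsub>PSL2 O43\<^esub> = PSL2_class O43 (word_matrix [])"
    using word_value_PSL2[of "[]"] by simp
  then show ?thesis
    using word_matrix_relator[OF assms] PSL2_class_eq_iff[OF word_matrix_closed word_matrix_closed, of r "[]"]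
    by (simp add: word_value_PSL2)
qed

lemma weq_word_matrix:
  assumes "u \<doteq> v"
  shows "word_matrix u = word_matrix v \<or> word_matrix u = - word_matrix v"
  using group.word_value_word_eq[OF group_PSL2_43 _ relator_value_PSL2 assms]
    PSL2_class_eq_iff[OF word_matrix_closed word_matrix_closed, of u v]
  by (simp add: word_value_PSL2 PSL2_class_in_carrier gen_matrix_in_SL2)

section \<open>Heights and face moves\<close>

text \<open>A condition on the letters, stronger than having lower left entry 0: that every word of
  the second kind is equivalent to one of the first is part of what has to be proved.\<close>

definition parabolic :: "bianchi_gen letter list \<Rightarrow> bool" where
  "parabolic p \<longleftrightarrow> set p \<subseteq> {A, A', U, U'}"

lemma parabolic_simps [simp]:
  "parabolic []"
  "parabolic (x # p) \<longleftrightarrow> x \<in> {A, A', U, U'} \<and> parabolic p"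
  "parabolic (p @ q) \<longleftrightarrow> parabolic p \<and> parabolic q"
  by (auto simp: parabolic_def)

lemma parabolic_winv: "parabolic p \<Longrightarrow> parabolic (winv p)"
  by (induction p) auto

lemma parabolic_matrix:
  "parabolic p \<Longrightarrow> word_matrix p $ 1 $ 1 = 1 \<and> word_matrix p $ 2 $ 1 = 0 \<and> word_matrix p $ 2 $ 2 = 1"
proof (induction p)
  case Nil
  then show ?case by (simp add: mat_def)
next
  case (Cons x p)
  then show ?case
    by (auto simp: matrix_mult_2_entry letter_matrix_simps simp del: letter_value.simps(2))
qed

text \<open>Only the bottom row \<open>(c, d)\<close> of the left factor enters the lower left entry
  of a product, so the geometry of the discs can be studied for arbitrary complex \<open>c\<close>
  and \<open>d\<close>.\<close>

definition height :: "complex \<Rightarrow> complex \<Rightarrow> bianchi_gen letter list \<Rightarrow> real" where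
  "height c d v = (cmod (c * word_matrix v $ 1 $ 1 + d * word_matrix v $ 2 $ 1))\<^sup>2"

definition ht :: "bianchi_gen letter list \<Rightarrow> real" where
  "ht w = (cmod (word_matrix w $ 2 $ 1))\<^sup>2"

lemma ht_append: "ht (u @ v) = height (word_matrix u $ 2 $ 1) (word_matrix u $ 2 $ 2) v"
  by (simp add: ht_def height_def word_matrix_append matrix_mult_2_entry)

lemma ht_append_parabolic: "parabolic p \<Longrightarrow> ht (w @ p) = ht w"
  using parabolic_matrix[of p] by (simp add: ht_append height_def) (simp add: ht_def)

lemma height_append_parabolic:
  assumes "parabolic p"
  obtains t where "\<And>c d v. height c d (p @ v) = height c (d + c * t) v"
proof
  fix c d v
  show "height c d (p @ v) = height c (d + c * word_matrix p $ 1 $ 2) v"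
    using parabolic_matrix[OF assms]
    by (simp add: height_def word_matrix_append matrix_mult_2_entry algebra_simps)
qed

lemma ht_cong: "u \<doteq> v \<Longrightarrow> ht u = ht v"
  using weq_word_matrix[of u v] by (auto simp: ht_def)

lemma height_cong: "u \<doteq> v \<Longrightarrow> height c d u = height c d v"
proof -
  have "cmod (- (c * x) - d * y) = cmod (c * x + d * y)" for x y
    using norm_minus_cancel[of "c * x + d * y"] by (simp add: algebra_simps)
  then show "u \<doteq> v \<Longrightarrow> height c d u = height c d v"
    using weq_word_matrix[of u v] by (auto simp: height_def)
qed

text \<open>For a column \<open>(r, s)\<close>, the coefficients of the Hermitian form \<open>|cr + ds|\<^sup>2\<close> in \<open>(c, d)\<close>:
  \<open>|r|\<^sup>2\<close>, \<open>|s|\<^sup>2\<close>, and the coordinates of \<open>r\<close> times the conjugate of \<open>s\<close>.\<close>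

definition height_form :: "bianchi_gen letter list \<Rightarrow> int \<times> int \<times> int \<times> int" where
  "height_form v = (case word_col v (1, 0, 0, 0) of (a, b, e, f) \<Rightarrow>
     (a * a + a * b + 11 * (b * b), e * e + e * f + 11 * (f * f),
      a * e + a * f + 11 * (b * f), b * e - a * f))"

lemma Re_Im_omega: "Re omega = 1 / 2" "Im omega = sqrt 43 / 2"
  by (simp_all add: omega_def csqrt_43)

lemma cnj_omega: "cnj omega = 1 - omega"
  by (simp add: complex_eq_iff Re_Im_omega)

lemma zom_mult_cnj:
  "zom a b * cnj (zom e f) = of_int (a * e + a * f + 11 * (b * f)) + of_int (b * e - a * f) * omega"
  by (simp add: zom_def cnj_omega algebra_simps omega_square omega_square_left)

lemma norm_zom: "(cmod (zom a b))\<^sup>2 = of_int (a * a + a * b + 11 * (b * b))"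
proof -
  have "complex_of_real ((cmod (zom a b))\<^sup>2) = zom a b * cnj (zom a b)"
    by (simp only: complex_norm_square)
  also have "\<dots> = complex_of_real (of_int (a * a + a * b + 11 * (b * b)))"
    by (simp add: zom_mult_cnj)
  finally show ?thesis by (simp only: of_real_eq_iff)
qed

lemma norm_add_square: "(cmod (x + y))\<^sup>2 = (cmod x)\<^sup>2 + (cmod y)\<^sup>2 + 2 * Re (x * cnj y)"
  by (simp add: cmod_power2) (simp add: power2_eq_square algebra_simps)

lemma height_eq_form:
  assumes "height_form v = (n, m, p, q)"
  shows "height c d v = n * (cmod c)\<^sup>2 + m * (cmod d)\<^sup>2 + p * (2 * Re (c * cnj d)) + q * (2 * Re (c * cnj d * omega))"
proof -
  obtain a b e f where col: "word_col v (1, 0, 0, 0) = (a, b, e, f)"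
    by (metis prod_cases4)
  have ent: "word_matrix v $ 1 $ 1 = zom a b" "word_matrix v $ 2 $ 1 = zom e f"
    using word_col_correct[of v 1 a b e f] col by auto
  have nmpq: "n = a * a + a * b + 11 * (b * b)" "m = e * e + e * f + 11 * (f * f)"
    "p = a * e + a * f + 11 * (b * f)" "q = b * e - a * f"
    using assms by (auto simp: height_form_def col)
  have "c * zom a b * cnj (d * zom e f) = c * cnj d * (zom a b * cnj (zom e f))" by simp
  also have "\<dots> = of_int p * (c * cnj d) + of_int q * (c * cnj d * omega)"
    unfolding zom_mult_cnj nmpq by (simp add: algebra_simps)
  finally have *: "c * zom a b * cnj (d * zom e f) = of_int p * (c * cnj d) + of_int q * (c * cnj d * omega)" .
  have "height c d v = (cmod (c * zom a b))\<^sup>2 + (cmod (d * zom e f))\<^sup>2 + 2 * Re (c * zom a b * cnj (d * zom e f))"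
    unfolding height_def ent by (rule norm_add_square)
  also have "\<dots> = n * (cmod c)\<^sup>2 + m * (cmod d)\<^sup>2 + p * (2 * Re (c * cnj d)) + q * (2 * Re (c * cnj d * omega))"
    unfolding * by (simp add: norm_mult power_mult_distrib norm_zom nmpq algebra_simps)
  finally show ?thesis .
qed

text \<open>The condition says that \<open>k|x|\<^sup>2 = \<alpha>|u|\<^sup>2 + \<beta>|v|\<^sup>2 + (k - \<alpha> - \<beta>)|c|\<^sup>2\<close> for the heights of \<open>x\<close>, \<open>u\<close>, \<open>v\<close> as forms
  in \<open>(c, d)\<close>. It holds for the further cusps \<open>x\<close> around an edge of the Ford domain that is shared by the
  hemispheres of \<open>u\<close> and \<open>v\<close>, because the hemispheres through one geodesic form a pencil.\<close>

definition height_between :: "int \<times> int \<times> int \<Rightarrow> bianchi_gen letter list \<Rightarrow> bianchi_gen letter list \<Rightarrow>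
    bianchi_gen letter list \<Rightarrow> bool" where
  "height_between n u v x \<longleftrightarrow> (case (n, height_form u, height_form v, height_form x) of
     ((k, \<alpha>, \<beta>), (u1, u2, u3, u4), (v1, v2, v3, v4), (x1, x2, x3, x4)) \<Rightarrow>
       0 < k \<and> 0 < \<alpha> \<and> 0 < \<beta> \<and> k * x1 = \<alpha> * u1 + \<beta> * v1 + (k - \<alpha> - \<beta>) \<and>
       k * x2 = \<alpha> * u2 + \<beta> * v2 \<and> k * x3 = \<alpha> * u3 + \<beta> * v3 \<and> k * x4 = \<alpha> * u4 + \<beta> * v4)"

text \<open>A positive combination of two weak inequalities, one of them strict. The coefficient
  \<open>k - \<alpha> - \<beta>\<close> may have either sign, because it multiplies
  \<open>(cmod c)\<^sup>2\<close> itself.\<close>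

lemma height_less_of_between:
  assumes "height_between n u v x" "height c d u \<le> (cmod c)\<^sup>2" "height c d v \<le> (cmod c)\<^sup>2"
    and "height c d u < (cmod c)\<^sup>2 \<or> height c d v < (cmod c)\<^sup>2"
  shows "height c d x < (cmod c)\<^sup>2"
proof -
  obtain k \<alpha> \<beta> where n: "n = (k, \<alpha>, \<beta>)" by (metis prod_cases3)
  obtain u1 u2 u3 u4 where u: "height_form u = (u1, u2, u3, u4)" by (metis prod_cases4)
  obtain v1 v2 v3 v4 where v: "height_form v = (v1, v2, v3, v4)" by (metis prod_cases4)
  obtain x1 x2 x3 x4 where x: "height_form x = (x1, x2, x3, x4)" by (metis prod_cases4)
  have pos: "0 < k" "0 < \<alpha>" "0 < \<beta>"
    and e: "k * x1 = \<alpha> * u1 + \<beta> * v1 + (k - \<alpha> - \<beta>)" "k * x2 = \<alpha> * u2 + \<beta> * v2"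
      "k * x3 = \<alpha> * u3 + \<beta> * v3" "k * x4 = \<alpha> * u4 + \<beta> * v4"
    using assms(1) by (auto simp: height_between_def n u v x)
  define c2 d2 y z where "c2 = (cmod c)\<^sup>2" "d2 = (cmod d)\<^sup>2" "y = 2 * Re (c * cnj d)"
    "z = 2 * Re (c * cnj d * omega)"
  note h = height_eq_form[of _ _ _ _ _ c d, folded c2_d2_y_z_def]
  have "k * height c d x = (k * x1) * c2 + (k * x2) * d2 + (k * x3) * y + (k * x4) * z"
    by (simp add: h[OF x] algebra_simps)
  also have "\<dots> = \<alpha> * height c d u + \<beta> * height c d v + (k - \<alpha> - \<beta>) * c2"
    unfolding e h[OF u] h[OF v] by (simp add: algebra_simps)
  also have "\<dots> < \<alpha> * c2 + \<beta> * c2 + (k - \<alpha> - \<beta>) * c2"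
  proof -
    have le: "\<alpha> * height c d u \<le> \<alpha> * c2" "\<beta> * height c d v \<le> \<beta> * c2"
      using assms(2,3) pos by (simp_all add: c2_d2_y_z_def)
    have "\<alpha> * height c d u < \<alpha> * c2 \<or> \<beta> * height c d v < \<beta> * c2"
      using assms(4) pos by (simp add: c2_d2_y_z_def)
    with le show ?thesis by linarith
  qed
  also have "\<dots> = k * c2" by (simp add: algebra_simps)
  finally show ?thesis using pos by (simp add: c2_d2_y_z_def)
qed

text \<open>In this order the words send \<infinity> to 0, \<omega>/2, (1+\<omega>)/2, \<omega>/3,
  (1+\<omega>)/3, (2+\<omega>)/3, 2\<omega>/3, (1+2\<omega>)/3 and (2+2\<omega>)/3.\<close>

definition faces :: "bianchi_gen letter list set" where
  "faces = {[B], [U, R'], [R], [S, R'], [A, B, S, U', R, S'], [A, B, S], [U, S', B], [R, S'],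
    [A, U, S', B, S, R']}"

type_synonym move = "bianchi_gen letter list \<times> bianchi_gen letter list \<times> bianchi_gen letter list"

fun move_word :: "move \<Rightarrow> bianchi_gen letter list" where
  "move_word (p, W, q) = p @ W @ q"

fun is_move :: "move \<Rightarrow> bool" where
  "is_move (p, W, q) \<longleftrightarrow> parabolic p \<and> W \<in> faces \<and> parabolic q"

definition step :: "bianchi_gen letter list \<Rightarrow> bianchi_gen letter list \<Rightarrow> bool" where
  "step u v \<longleftrightarrow> (\<exists>m. is_move m \<and> v \<doteq> u @ move_word m)"

section \<open>Relations between face words\<close>

lemma bianchi_relators_trivial:
  "[B, B] \<doteq> []"
  "[B, A, B, A, B, A] \<doteq> []"
  "[A, U, A', U'] \<doteq> []"
  "[R', U, R', U, R', U] \<doteq> []"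
  "[A', R, A', U', R, A', R', U, R'] \<doteq> []"
  "[A', R, U', S, R', U, B, S', B] \<doteq> []"
  "[U, A, S', B, S, R', U, A, S', B, S, R'] \<doteq> []"
  "[B, S, U', R, S', A, B, S, U', R, S', A] \<doteq> []"
  by (intro word_eq_relator; simp add: bianchi_relators_def Let_def word_power_def numeral_eq_Suc)+

lemmas word_eval = reduce_def winv_def

text \<open>A cube, like \<open>relator_h1\<close> and \<open>relator_h2\<close>, while
  \<open>relator_q1\<close> and \<open>relator_q2\<close> are squares. The squares serve edges with
  four cusps and the two other cubes edges with six; this one also enters the derivations of
  \<open>relator_q2\<close> and \<open>relator_h2\<close>.\<close>

lemma relator_t: "[R, U', A', R, U', A', R, U', A'] \<doteq> []"
  by (rule word_eq_conj_prod[of "[([R, U', A', R, U', A'], [A, U, A', U'], False),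
      ([R, U'], [A', R, A', U', R, A', R', U, R'], True),
      ([R], [R', U, R', U, R', U], False),
      ([], [A, U, A', U'], False)]"])
    (simp_all add: bianchi_relators_trivial word_eval)

lemma relator_q1: "[R', A, B, S, U', R, S', U, R', A, B, S, U', R, S', U] \<doteq> []"
  by (rule word_eq_conj_prod[of "[([R', A, B, S, U', R, S', U, R', A], [A', R, U', S, R', U, B, S', B], False),
      ([R', A, B, S, B, S'], [B, B], True),
      ([R', A, B, S], [B, B], True),
      ([R', A, B, S, B', U', R, S', U, R', A], [A', R, U', S, R', U, B, S', B], False),
      ([R', A], [B, B], True)]"])
    (simp_all add: bianchi_relators_trivial word_eval)

lemma relator_q2: "[R', A, U, S', B, S, R', A, U, R', A, U, S', B, S, R', A, U] \<doteq> []"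
  by (rule word_eq_conj_prod[of "[([R', A, U, S', B, S, R'], [R, U', A', R, U', A', R, U', A'], False),
      ([R', A, U, S', B, S, U', A'], [A, U, A', U'], False),
      ([R', A, U, S', B, S, A', U', R, S'], [B, B], True),
      ([R', A, U, S', B, S, A', U'], [U, A, S', B, S, R', U, A, S', B, S, R'], False),
      ([R', A, U, S'], [B, B], True),
      ([R', A, U, R', U, A, R', A], [A', R, A', U', R, A', R', U, R'], False),
      ([R', A, U, A'], [R', U, R', U, R', U], True),
      ([R'], [A, U, A', U'], True)]"])
    (simp_all add: bianchi_relators_trivial relator_t word_eval)

text \<open>As \<open>B\<close> is its own inverse, the cubed word is the conjugate of
  \<open>[U', R]\<close> by \<open>[B, S]\<close>, so this is a conjugate of the inverse of the
  relator \<open>[R', U, R', U, R', U]\<close>.\<close>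

lemma relator_h1: "[B, S, U', R, S', B, B, S, U', R, S', B, B, S, U', R, S', B] \<doteq> []"
  by (rule word_eq_conj_prod[of "[([B, S, U', R, S', B, B, S, U', R, S'], [B, B], True),
      ([B, S, U', R, S'], [B, B], True),
      ([B, S], [R', U, R', U, R', U], False),
      ([], [B, B], True)]"])
    (simp_all add: bianchi_relators_trivial word_eval)

lemma relator_h2: "[R, S', B', S, B, U', R, S', B', S, B, U', R, S', B', S, B, U'] \<doteq> []"
  by (rule word_eq_conj_prod[of "[([R, S', B', S, B, U', R, S', B', S], [B, B], True),
      ([R, S', B', S, B, U', R, S'], [A', R, U', S, R', U, B, S', B], False),
      ([R, S', B', S], [B, B], True),
      ([R, S'], [A', R, U', S, R', U, B, S', B], False),
      ([R, S', A'], [R, U', A', R, U', A', R, U', A'], True),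
      ([R, S', U, R', A], [A', R, U', S, R', U, B, S', B], False),
      ([U], [B, B], True)]"])
    (simp_all add: bianchi_relators_trivial relator_t word_eval)

lemmas trivial_words = bianchi_relators_trivial relator_t relator_q1 relator_q2 relator_h1 relator_h2

text \<open>A matrix and its inverse have lower left entries of equal norm, so the inverse of a face
  again leads, up to translations, to one of the nine cusps. Six faces are interchanged in pairs.
  Those with cusps 0, (1+\<omega>)/3 and (2+2\<omega>)/3 are paired with themselves, which is where
  the three relators that are squares enter.\<close>

lemma winv_face:
  assumes "W \<in> faces"
  shows "\<exists>m. is_move m \<and> winv W \<doteq> move_word m"
proof -
  have f1: "\<exists>m. is_move m \<and> winv [B] \<doteq> move_word m"
    by (intro exI[of _ "([], [B], [])"] conjI, simp add: faces_def,
    rule word_eq_conj_prod[of "[([], [B, B], False)]"], simp_all add: trivial_words word_eval)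
  have f2: "\<exists>m. is_move m \<and> winv [U, R'] \<doteq> move_word m"
    by (intro exI[of _ "([], [R], [U'])"] conjI, simp add: faces_def,
    rule word_eq_reduce, simp add: word_eval)
  have f3: "\<exists>m. is_move m \<and> winv [R] \<doteq> move_word m"
    by (intro exI[of _ "([U'], [U, R'], [])"] conjI, simp add: faces_def,
    rule word_eq_reduce, simp add: word_eval)
  have f4: "\<exists>m. is_move m \<and> winv [S, R'] \<doteq> move_word m"
    by (intro exI[of _ "([], [R, S'], [])"] conjI, simp add: faces_def,
    rule word_eq_reduce, simp add: word_eval)
  have f5: "\<exists>m. is_move m \<and> winv [A, B, S, U', R, S'] \<doteq> move_word m"
    by (intro exI[of _ "([], [A, B, S, U', R, S'], [])"] conjI, simp add: faces_def,
    rule word_eq_conj_prod[of "[([S, R', U, S', B'], [B, S, U', R, S', A, B, S, U', R, S', A], False)]"], simp_all add: trivial_words word_eval)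
  have f6: "\<exists>m. is_move m \<and> winv [A, B, S] \<doteq> move_word m"
    by (intro exI[of _ "([U'], [U, S', B], [A'])"] conjI, simp add: faces_def,
    rule word_eq_conj_prod[of "[([S'], [B, B], False)]"], simp_all add: trivial_words word_eval)
  have f7: "\<exists>m. is_move m \<and> winv [U, S', B] \<doteq> move_word m"
    by (intro exI[of _ "([A'], [A, B, S], [U'])"] conjI, simp add: faces_def,
    rule word_eq_conj_prod[of "[([], [B, B], False)]"], simp_all add: trivial_words word_eval)
  have f8: "\<exists>m. is_move m \<and> winv [R, S'] \<doteq> move_word m"
    by (intro exI[of _ "([], [S, R'], [])"] conjI, simp add: faces_def,
    rule word_eq_reduce, simp add: word_eval)
  have f9: "\<exists>m. is_move m \<and> winv [A, U, S', B, S, R'] \<doteq> move_word m"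
    by (intro exI[of _ "([], [A, U, S', B, S, R'], [])"] conjI, simp add: faces_def,
    rule word_eq_conj_prod[of "[([R, S', B', S, U', A'], [A, U, A', U'], False),
      ([], [U, A, S', B, S, R', U, A, S', B, S, R'], False),
      ([], [A, U, A', U'], False)]"], simp_all add: trivial_words word_eval)
  from assms f1 f2 f3 f4 f5 f6 f7 f8 f9 show ?thesis
    unfolding faces_def by (elim insertE emptyE) (simp_all only:)
qed
lemma stepI: "is_move m \<Longrightarrow> v \<doteq> u @ move_word m \<Longrightarrow> step u v"
  unfolding step_def by blast

lemma weq_append_right: "u \<doteq> v \<Longrightarrow> u @ w \<doteq> v @ w"
  by (rule word_eq_append) auto

lemma weq_append_left: "u \<doteq> v \<Longrightarrow> w @ u \<doteq> w @ v"
  by (rule word_eq_append) auto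

lemma is_move_winv:
  assumes "is_move m"
  shows "\<exists>m'. is_move m' \<and> winv (move_word m) \<doteq> move_word m'"
proof -
  obtain p W q where m: "m = (p, W, q)" by (metis prod_cases3)
  then have pq: "parabolic p" "W \<in> faces" "parabolic q" using assms by auto
  obtain m0 where m0: "is_move m0" "winv W \<doteq> move_word m0" using winv_face[OF pq(2)] by blast
  obtain p' W' q' where m': "m0 = (p', W', q')" by (metis prod_cases3)
  have "is_move (winv q @ p', W', q' @ winv p)"
    using pq m0(1) by (simp add: m' parabolic_winv)
  moreover have "winv W @ winv p \<doteq> (p' @ W' @ q') @ winv p"
    using m0(2) unfolding m' by (intro weq_append_right) simp
  then have "winv q @ winv W @ winv p \<doteq> winv q @ (p' @ W' @ q') @ winv p"
    by (rule weq_append_left)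
  then have "winv (move_word m) \<doteq> move_word (winv q @ p', W', q' @ winv p)"
    by (simp add: m)
  ultimately show ?thesis by blast
qed

lemma step_sym: "step u v \<Longrightarrow> step v u"
proof -
  assume "step u v"
  then obtain m where m: "is_move m" "v \<doteq> u @ move_word m" unfolding step_def by blast
  then obtain m' where m': "is_move m'" "winv (move_word m) \<doteq> move_word m'"
    using is_move_winv by blast
  have "u \<doteq> v @ winv (move_word m)"
    by (rule word_eq_move_right[OF word_eq_sym[OF m(2)]])
  also have "\<dots> \<doteq> v @ move_word m'"
    by (rule weq_append_left[OF m'(2)])
  finally show "step v u" by (rule stepI[OF m'(1)])
qed

lemma step_append_left: "step u v \<Longrightarrow> step (w @ u) (w @ v)"
  unfolding step_def using weq_append_left[of v _ w] by auto

lemma step_cong: "step u v \<Longrightarrow> u \<doteq> u' \<Longrightarrow> v \<doteq> v' \<Longrightarrow> step u' v'"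
proof -
  assume "step u v" and uv: "u \<doteq> u'" "v \<doteq> v'"
  then obtain m where m: "is_move m" "v \<doteq> u @ move_word m" unfolding step_def by blast
  note word_eq_sym[OF uv(2)]
  also note m(2)
  also note weq_append_right[OF uv(1)]
  finally show "step u' v'" by (rule stepI[OF m(1)])
qed

section \<open>Paths through the discs that contain a point\<close>

abbreviation low :: "complex \<Rightarrow> complex \<Rightarrow> bianchi_gen letter list \<Rightarrow> bool" where
  "low c d v \<equiv> height c d v < (cmod c)\<^sup>2"

definition low_step :: "complex \<Rightarrow> complex \<Rightarrow> bianchi_gen letter list \<Rightarrow> bianchi_gen letter list \<Rightarrow> bool" where
  "low_step c d u v \<longleftrightarrow> step u v \<and> low c d u \<and> low c d v"

text \<open>The first vertex of a link may lie on the boundary circle of its disc, where a move preserves the height.\<close>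

definition link :: "complex \<Rightarrow> complex \<Rightarrow> bianchi_gen letter list \<Rightarrow> bianchi_gen letter list \<Rightarrow> bool" where
  "link c d u v \<longleftrightarrow> (\<exists>x. step u x \<and> low c d x \<and> (low_step c d)\<^sup>*\<^sup>* x v)"

text \<open>With \<open>c\<close> and \<open>d\<close> arbitrary, z = -d/c ranges over the
  intersection of the two closed discs. Nothing is claimed where both heights tie; where one ties,
  the path from that end must already be low after its first step.\<close>

definition edge :: "bianchi_gen letter list \<Rightarrow> bianchi_gen letter list \<Rightarrow> bool" where
  "edge u v \<longleftrightarrow> (\<forall>c d. height c d u \<le> (cmod c)\<^sup>2 \<longrightarrow> height c d v \<le> (cmod c)\<^sup>2 \<longrightarrow>
     (low c d v \<longrightarrow> link c d u v) \<and> (low c d u \<longrightarrow> link c d v u))"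

lemma edge_sym: "edge u v \<Longrightarrow> edge v u"
  by (auto simp: edge_def)

lemma low_step_sym: "low_step c d u v \<Longrightarrow> low_step c d v u"
  by (auto simp: low_step_def intro: step_sym)

lemma low_path_sym: "(low_step c d)\<^sup>*\<^sup>* u v \<Longrightarrow> (low_step c d)\<^sup>*\<^sup>* v u"
  by (induction rule: rtranclp_induct) (auto intro: low_step_sym converse_rtranclp_into_rtranclp)

lemma link_imp_low_path: "link c d u v \<Longrightarrow> low c d u \<Longrightarrow> (low_step c d)\<^sup>*\<^sup>* u v"
  by (auto simp: link_def low_step_def[of c d u] intro: converse_rtranclp_into_rtranclp)

text \<open>The triple stored with a move certifies the vertex that the move reaches. The last move
  ends at \<open>v\<close> itself, which is not an intermediate vertex and so is not tested by
  \<open>height_between\<close>.\<close>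

fun chain_ok :: "bianchi_gen letter list \<Rightarrow> bianchi_gen letter list \<Rightarrow> bianchi_gen letter list \<Rightarrow>
    ((int \<times> int \<times> int) \<times> move) list \<Rightarrow> bool" where
  "chain_ok u v x [] \<longleftrightarrow> False"
| "chain_ok u v x [(n, m)] \<longleftrightarrow> is_move m"
| "chain_ok u v x ((n, m) # m' # ms) \<longleftrightarrow>
     is_move m \<and> height_between n u v (x @ move_word m) \<and> chain_ok u v (x @ move_word m) (m' # ms)"

fun chain_end :: "bianchi_gen letter list \<Rightarrow> ((int \<times> int \<times> int) \<times> move) list \<Rightarrow> bianchi_gen letter list" where
  "chain_end x [] = x"
| "chain_end x ((n, m) # ms) = chain_end (x @ move_word m) ms"

lemma chain_link:
  assumes "\<And>n x. height_between n u v x \<Longrightarrow> low c d x" "low c d v"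
    and "chain_ok u v x ms" "v \<doteq> chain_end x ms"
  shows "link c d x v"
  using assms(3,4)
proof (induction ms arbitrary: x)
  case (Cons nm ms)
  obtain n m where nm: "nm = (n, m)" by (metis surj_pair)
  show ?case
  proof (cases ms)
    case Nil
    then have "step x v" using Cons.prems nm by (simp add: stepI[of m])
    then show ?thesis using assms(2) by (auto simp: link_def)
  next
    case (Cons nm' ms')
    let ?y = "x @ move_word m"
    have y: "is_move m" "chain_ok u v ?y ms" "v \<doteq> chain_end ?y ms" and "height_between n u v ?y"
      using Cons.prems unfolding nm Cons by auto
    then have low: "low c d ?y" by (intro assms(1))
    have "link c d ?y v" using y by (intro Cons.IH)
    then have "(low_step c d)\<^sup>*\<^sup>* ?y v" using low by (rule link_imp_low_path)
    moreover have "step x ?y" using y(1) by (rule stepI) simp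
    ultimately show ?thesis using low unfolding link_def by blast
  qed
qed simp

text \<open>Read backwards, the chain may start on the boundary circle of \<open>v\<close>: all
  intermediate vertices are low, so only the last move of the chain, now taken first, touches a
  vertex that may tie.\<close>

lemma chain_link_rev:
  assumes "\<And>n x. height_between n u v x \<Longrightarrow> low c d x"
    and "low c d x" "chain_ok u v x ms" "v \<doteq> chain_end x ms"
  shows "link c d v x"
  using assms(2-)
proof (induction ms arbitrary: x)
  case (Cons nm ms)
  obtain n m where nm: "nm = (n, m)" by (metis surj_pair)
  show ?case
  proof (cases ms)
    case Nil
    then have "step x v" using Cons.prems nm by (simp add: stepI[of m])
    then show ?thesis using Cons.prems(1) step_sym by (auto simp: link_def)
  next
    case (Cons nm' ms')
    let ?y = "x @ move_word m"
    have y: "is_move m" "chain_ok u v ?y ms" "v \<doteq> chain_end ?y ms" and "height_between n u v ?y"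
      using Cons.prems unfolding nm Cons by auto
    then have low: "low c d ?y" by (intro assms(1))
    have "link c d v ?y" using low y by (intro Cons.IH)
    then obtain z where "step v z" "low c d z" "(low_step c d)\<^sup>*\<^sup>* z ?y"
      unfolding link_def by blast
    moreover have "step ?y x" using step_sym[OF stepI[OF y(1)]] by simp
    then have "low_step c d ?y x" using low Cons.prems(1) by (simp add: low_step_def)
    ultimately show ?thesis unfolding link_def by (meson rtranclp.rtrancl_into_rtrancl)
  qed
qed simp

lemma edge_of_chain:
  assumes "chain_ok u v u ms" "v \<doteq> chain_end u ms"
  shows "edge u v"
  unfolding edge_def
proof (intro allI impI conjI)
  fix c d
  assume le: "height c d u \<le> (cmod c)\<^sup>2" "height c d v \<le> (cmod c)\<^sup>2"
  show "link c d u v" if "low c d v"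
    using height_less_of_between[OF _ le] that assms by (intro chain_link[where u = u]) auto
  show "link c d v u" if "low c d u"
    using height_less_of_between[OF _ le] that assms by (intro chain_link_rev[where u = u]) auto
qed

text \<open>Equivalent words are still different vertices, and an empty path cannot pass from one to
  the other. The exchange is therefore absorbed into the last step of the path, or into the step
  from \<open>u\<close> if the path is empty.\<close>

lemma low_path_cong:
  assumes "(low_step c d)\<^sup>*\<^sup>* x v" "v \<doteq> v'" "step u x" "low c d x"
  shows "link c d u v'"
  using assms(1)
proof (cases rule: rtranclp.cases)
  case rtrancl_refl
  then have "step u v'" "low c d v'"
    using step_cong[OF assms(3) word_eq_refl, of v'] height_cong[OF assms(2), of c d] assms(2,4)
    by auto
  then show ?thesis by (auto simp: link_def)
next
  case (rtrancl_into_rtrancl y)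
  then have "low_step c d y v'"
    using step_cong[OF _ word_eq_refl assms(2), of y] height_cong[OF assms(2), of c d]
    by (simp add: low_step_def)
  then show ?thesis
    using rtrancl_into_rtrancl assms(3,4) unfolding link_def
    by (meson rtranclp.rtrancl_into_rtrancl)
qed

lemma link_cong:
  assumes "link c d u v" "u \<doteq> u'" "v \<doteq> v'"
  shows "link c d u' v'"
proof -
  obtain x where "step u x" "low c d x" "(low_step c d)\<^sup>*\<^sup>* x v"
    using assms(1) unfolding link_def by blast
  then show ?thesis
    using low_path_cong[OF _ assms(3)] step_cong[OF _ assms(2) word_eq_refl] by blast
qed

lemma edge_cong:
  assumes "edge u v" "u \<doteq> u'" "v \<doteq> v'"
  shows "edge u' v'"
  using assms(1) height_cong[OF assms(2)] height_cong[OF assms(3)]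
    link_cong[OF _ assms(2,3)] link_cong[OF _ assms(3,2)]
  by (simp add: edge_def)

lemma link_append_left:
  assumes "link c d' u v" and height: "\<And>v. height c d (p @ v) = height c d' v"
  shows "link c d (p @ u) (p @ v)"
proof -
  obtain x where x: "step u x" "low c d' x" "(low_step c d')\<^sup>*\<^sup>* x v"
    using assms(1) unfolding link_def by blast
  from x(3) have "(low_step c d)\<^sup>*\<^sup>* (p @ x) (p @ v)"
  proof induction
    case (step y z)
    then have "low_step c d (p @ y) (p @ z)"
      by (simp add: low_step_def height step_append_left)
    with step.IH show ?case by simp
  qed simp
  moreover have "step (p @ u) (p @ x)" using x(1) by (rule step_append_left)
  ultimately show ?thesis using x(2) unfolding link_def height[symmetric] by blast
qed

text \<open>A translation in front replaces \<open>d\<close> by \<open>d + c * t\<close>, that is,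
  shifts z by -t. Since \<open>edge\<close> speaks of all \<open>d\<close>, it is invariant, and one
  representative of each edge suffices.\<close>

lemma edge_append_left:
  assumes "edge u v" "parabolic p"
  shows "edge (p @ u) (p @ v)"
proof -
  obtain t where "\<And>c d v. height c d (p @ v) = height c (d + c * t) v"
    using height_append_parabolic[OF assms(2)] by metis
  note h = this
  have "link c d (p @ x) (p @ y)" if "link c (d + c * t) x y" for c d x y
    using that h by (rule link_append_left)
  then show ?thesis using assms(1) by (simp add: edge_def h)
qed

section \<open>Discs indexed by their centres\<close>

definition translation :: "int \<Rightarrow> int \<Rightarrow> bianchi_gen letter list" where
  "translation k l = (if 0 \<le> k then replicate (nat k) A else replicate (nat (- k)) A')
     @ (if 0 \<le> l then replicate (nat l) U else replicate (nat (- l)) U')"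

definition face0 :: "int \<Rightarrow> int \<Rightarrow> int \<Rightarrow> bianchi_gen letter list" where
  "face0 s k l =
    (if s = 1 then [B] else if s = 2 then (if k = 0 then [U, R'] else [R])
     else if l = 1 then (if k = 0 then [S, R'] else if k = 1 then [A, B, S, U', R, S'] else [A, B, S])
     else (if k = 0 then [U, S', B] else if k = 1 then [R, S'] else [A, U, S', B, S, R']))"

text \<open>For \<open>s \<in> {1, 2, 3}\<close> and, if \<open>s \<noteq> 1\<close>, \<open>l\<close> prime to \<open>s\<close>, a word whose matrix sends \<open>\<infinity>\<close> to the
  cusp \<open>(k + l\<omega>) / s\<close>.\<close>

definition face :: "int \<Rightarrow> int \<Rightarrow> int \<Rightarrow> bianchi_gen letter list" where
  "face s k l = translation (k div s) (l div s) @ face0 s (k mod s) (l mod s)"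

lemmas face_eval = face_def face0_def translation_def faces_def height_between_def height_form_def

section \<open>Edges between neighbouring discs, up to translation\<close>

text \<open>An edge of the Ford domain whose polygon of cusps has three, four or six vertices leads to a chain
  of one, two or four moves.\<close>

lemma edge_row1_0_0: "edge (face 1 0 0) (face 1 1 0)"
  by (rule edge_of_chain[where ms = "[((1, 1, 1), [A'], [B], [A'])]"])
    (simp add: face_eval, rule word_eq_conj_prod[of "[([A, B, A], [B, B], False),
      ([A], [B, A, B, A, B, A], True),
      ([], [B, B], False)]"],
      simp_all add: trivial_words word_eval face_eval)

lemma edge_row2_0_1: "edge (face 2 0 1) (face 2 1 1)"
  by (rule edge_of_chain[where ms = "[((1, 1, 1), [], [U, R'], [U])]"])
    (simp add: face_eval, rule word_eq_conj_prod[of "[([R], [R', U, R', U, R', U], False)]"],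
      simp_all add: trivial_words word_eval face_eval)

lemma edge_row2_1_1: "edge (face 2 1 1) (face 2 2 1)"
  by (rule edge_of_chain[where ms = "[((1, 1, 1), [A', U'], [R], [A', U'])]"])
    (simp add: face_eval, rule word_eq_conj_prod[of "[([A, U, R', U, A, R', U, A, R', A], [A', R, A', U', R, A', R', U, R'], False),
      ([A, U], [R', U, R', U, R', U], True)]"],
      simp_all add: trivial_words word_eval face_eval)

lemma edge_row3_0_1: "edge (face 3 0 1) (face 3 1 1)"
  by (rule edge_of_chain[where ms = "[((1, 1, 1), [], [U, S', B], [A'])]"])
    (simp add: face_eval, rule word_eq_conj_prod[of "[([A], [B, S, U', R, S', A, B, S, U', R, S', A], True),
      ([S, R', U, S'], [B, B], False)]"],
      simp_all add: trivial_words word_eval face_eval)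

lemma edge_row3_1_1: "edge (face 3 1 1) (face 3 2 1)"
  by (rule edge_of_chain[where ms = "[((1, 1, 1), [], [S, R'], [U])]"])
    (simp add: face_eval, rule word_eq_reduce, simp add: word_eval face_eval)

lemma edge_row3_2_1: "edge (face 3 2 1) (face 3 3 1)"
  by (rule edge_of_chain[where ms = "[((1, 1, 1), [A', U'], [A, U, S', B, S, R'], [])]"])
    (simp add: face_eval, rule word_eq_conj_prod[of "[([A, B', S, U', A'], [A, U, A', U'], False),
      ([A], [B, B], False)]"],
      simp_all add: trivial_words word_eval face_eval)

lemma edge_row3_0_2: "edge (face 3 0 2) (face 3 1 2)"
  by (rule edge_of_chain[where ms = "[((1, 1, 1), [A'], [A, B, S, U', R, S'], [])]"])
    (simp add: face_eval, rule word_eq_conj_prod[of "[([U, S'], [B, B], False)]"],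
      simp_all add: trivial_words word_eval face_eval)

lemma edge_row3_1_2: "edge (face 3 1 2) (face 3 2 2)"
  by (rule edge_of_chain[where ms = "[((1, 1, 1), [A'], [A, B, S], [A', U'])]"])
    (simp add: face_eval, rule word_eq_conj_prod[of "[([A, U, S', B, S, R'], [U, A, S', B, S, R', U, A, S', B, S, R'], True),
      ([A, U, A', U', R, S'], [B, B], False),
      ([], [A, U, A', U'], True)]"],
      simp_all add: trivial_words word_eval face_eval)

lemma edge_row3_2_2: "edge (face 3 2 2) (face 3 3 2)"
  by (rule edge_of_chain[where ms = "[((1, 1, 1), [], [R, S'], [])]"])
    (simp add: face_eval, rule word_eq_reduce, simp add: word_eval face_eval)

text \<open>In these names the leading digit is the denominator of the first row, \<open>u\<close>
  or \<open>d\<close> tells whether the row with denominator 3 lies above or below it, and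
  \<open>m\<close> means minus. Of the four discs that neighbour the unit disc on either side, the
  outer two give edges with six cusps and the inner two edges with four. The triples solve the
  linear equations of \<open>height_between\<close>.\<close>

lemma edge_1u_0_m2: "edge (face 1 0 0) (face 3 (-2) 1)"
  by (rule edge_of_chain[where ms = "[((1, 4, 1), [], [A, B, S, U', R, S'], []),
      ((3, 12, 4), [A], [B], []),
      ((3, 3, 4), [], [A, B, S, U', R, S'], []),
      ((1, 1, 1), [A], [B], [])]"])
    (simp add: face_eval, rule word_eq_conj_prod[of "[([B, S, U', R, S', B'], [B, S, U', R, S', A, B, S, U', R, S', A], False),
      ([B, S, U', R, U', R, S', B'], [B, S, U', R, S', A, B, S, U', R, S', A], False),
      ([B, S], [R', U, R', U, R', U], False)]"],
      simp_all add: trivial_words word_eval face_eval)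

lemma edge_1u_0_m1: "edge (face 1 0 0) (face 3 (-1) 1)"
  by (rule edge_of_chain[where ms = "[((1, 2, 1), [], [S, R'], []),
      ((1, 1, 1), [], [R], [])]"])
    (simp add: face_eval, rule word_eq_reduce, simp add: word_eval face_eval)

lemma edge_1u_0_0: "edge (face 1 0 0) (face 3 0 1)"
  by (rule edge_of_chain[where ms = "[((1, 2, 1), [A'], [A, B, S], []),
      ((1, 1, 1), [U'], [U, R'], [])]"])
    (simp add: face_eval, rule word_eq_conj_prod[of "[([], [B, B], False)]"],
      simp_all add: trivial_words word_eval face_eval)

lemma edge_1u_0_1: "edge (face 1 0 0) (face 3 1 1)"
  by (rule edge_of_chain[where ms = "[((1, 4, 1), [A'], [A, B, S, U', R, S'], []),
      ((3, 12, 4), [], [B], []),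
      ((3, 3, 4), [A'], [A, B, S, U', R, S'], []),
      ((1, 1, 1), [], [B], [A'])]"])
    (simp add: face_eval, rule word_eq_conj_prod[of "[([A, B, S, U', R, S', A], [B, S, U', R, S', B, B, S, U', R, S', B, B, S, U', R, S', B], False),
      ([A], [B, S, U', R, S', A, B, S, U', R, S', A], True)]"],
      simp_all add: trivial_words word_eval face_eval)

lemma edge_1d_0_m1: "edge (face 1 0 0) (face 3 (-1) (-1))"
  by (rule edge_of_chain[where ms = "[((1, 4, 1), [U'], [A, U, S', B, S, R'], []),
      ((3, 12, 4), [A, U], [B], []),
      ((3, 3, 4), [U'], [A, U, S', B, S, R'], []),
      ((1, 1, 1), [A, U], [B], [U'])]"])
    (simp add: face_eval, rule word_eq_conj_prod[of "[([A', U'], [A, U, A', U'], True),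
      ([S', B, S, R', U, B', U', A', R, S', B', S, U', A'], [A, U, A', U'], False),
      ([S', B, S, R', U, B', U', A', R, S', B', S, A', B', U', A', R, S', B', S, U', A'], [A, U, A', U'], False),
      ([S', B, S, R', U, B', U', A'], [A, U, A', U'], False),
      ([S', B, S, R', U, B', A', U'], [U, A, S', B, S, R', U, A, S', B, S, R'], False),
      ([S', B, S, R'], [R, S', B', S, B, U', R, S', B', S, B, U', R, S', B', S, B, U'], False),
      ([B, U', R, S', B', S, U', A'], [A, U, A', U'], False),
      ([B, U'], [U, A, S', B, S, R', U, A, S', B, S, R'], False)]"],
      simp_all add: trivial_words word_eval face_eval)

lemma edge_1d_0_0: "edge (face 1 0 0) (face 3 0 (-1))"
  by (rule edge_of_chain[where ms = "[((1, 2, 1), [U'], [R, S'], []),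
      ((1, 1, 1), [], [U, R'], [A])]"])
    (simp add: face_eval, rule word_eq_conj_prod[of "[([S', B], [A', R, U', S, R', U, B, S', B], True),
      ([], [B, B], False)]"],
      simp_all add: trivial_words word_eval face_eval)

lemma edge_1d_0_1: "edge (face 1 0 0) (face 3 1 (-1))"
  by (rule edge_of_chain[where ms = "[((1, 2, 1), [U'], [U, S', B], []),
      ((1, 1, 1), [A'], [R], [U'])]"])
    (simp add: face_eval, rule word_eq_conj_prod[of "[([U', R, S', U, R', A], [A', R, U', S, R', U, B, S', B], False)]"],
      simp_all add: trivial_words word_eval face_eval)

lemma edge_1d_0_2: "edge (face 1 0 0) (face 3 2 (-1))"
  by (rule edge_of_chain[where ms = "[((1, 4, 1), [A', U'], [A, U, S', B, S, R'], []),
      ((3, 12, 4), [U], [B], []),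
      ((3, 3, 4), [A', U'], [A, U, S', B, S, R'], []),
      ((1, 1, 1), [U], [B], [A', U'])]"])
    (simp add: face_eval, rule word_eq_conj_prod[of "[([U', A, U, S', B, S, R', U, A, B', U', R, S', B', S, U', A'], [A, U, A', U'], False),
      ([U', A, U, S', B, S, R', U, A, B', U', R, S', B', S, B', U', R, S', B', S, U', A'], [A, U, A', U'], False),
      ([U', A, U, S', B, S, R', U, A, B', U', R, S'], [A', R, U', S, R', U, B, S', B], False),
      ([U'], [A, U, A', U'], True),
      ([A, S', B, S, R'], [U, A, S', B, S, R', U, A, S', B, S, R'], True),
      ([U', R, S'], [A', R, U', S, R', U, B, S', B], False),
      ([U', R, S', A'], [R, U', A', R, U', A', R, U', A'], True),
      ([U', R, S', U, R', A], [A', R, U', S, R', U, B, S', B], False)]"],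
      simp_all add: trivial_words word_eval face_eval)

lemma edge_2d_0_0: "edge (face 2 0 1) (face 3 0 1)"
  by (rule edge_of_chain[where ms = "[((2, 1, 2), [], [A, B, S], []),
      ((1, 1, 1), [], [B], [U'])]"])
    (simp add: face_eval, rule word_eq_conj_prod[of "[([S, R', U], [B, B], False),
      ([S, R', U, B, S', B], [A', R, U', S, R', U, B, S', B], True),
      ([U, R', A], [B, B], False)]"],
      simp_all add: trivial_words word_eval face_eval)

lemma edge_2d_0_1: "edge (face 2 0 1) (face 3 1 1)"
  by (rule edge_of_chain[where ms = "[((1, 1, 1), [], [A, B, S, U', R, S'], []),
      ((1, 1, 1), [], [U, R'], [])]"])
    (simp add: face_eval, rule word_eq_conj_prod[of "[([A, B, S, U', R, S', R], [R', A, B, S, U', R, S', U, R', A, B, S, U', R, S', U], False),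
      ([A], [B, S, U', R, S', A, B, S, U', R, S', A], True)]"],
      simp_all add: trivial_words word_eval face_eval)

lemma edge_2d_1_1: "edge (face 2 1 1) (face 3 1 1)"
  by (rule edge_of_chain[where ms = "[((1, 1, 1), [U'], [A, B, S, U', R, S'], []),
      ((1, 1, 1), [], [R], [U'])]"])
    (simp add: face_eval, rule word_eq_conj_prod[of "[([A, B, S, U', R, S', U, R', A], [A', R, U', S, R', U, B, S', B], False),
      ([A, B, S, B, S', B], [B, S, U', R, S', A, B, S, U', R, S', A], False),
      ([A, B, S, B, S'], [B, B], True),
      ([A, B, S, B, U', R, S', U, R', A], [A', R, U', S, R', U, B, S', B], False),
      ([A, B, S], [B, B], True),
      ([A], [B, B], True)]"],
      simp_all add: trivial_words word_eval face_eval)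

lemma edge_2d_1_2: "edge (face 2 1 1) (face 3 2 1)"
  by (rule edge_of_chain[where ms = "[((2, 1, 2), [U'], [S, R'], []),
      ((1, 1, 1), [U], [B], [])]"])
    (simp add: face_eval, rule word_eq_conj_prod[of "[([A, B, S, B', U', R, S', U, R', A], [A', R, U', S, R', U, B, S', B], False),
      ([A], [B, B], True)]"],
      simp_all add: trivial_words word_eval face_eval)

lemma edge_2u_0_m1: "edge (face 2 0 1) (face 3 (-1) 2)"
  by (rule edge_of_chain[where ms = "[((1, 1, 1), [], [A, U, S', B, S, R'], []),
      ((1, 1, 1), [A], [U, R'], [])]"])
    (simp add: face_eval, rule word_eq_conj_prod[of "[([U, S', B, S], [R', A, U, S', B, S, R', A, U, R', A, U, S', B, S, R', A, U], False),
      ([U, S', B, S, R'], [A, U, A', U'], True),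
      ([U, S', B, S, R'], [U, A, S', B, S, R', U, A, S', B, S, R'], True),
      ([U, A', U'], [A, U, A', U'], True)]"],
      simp_all add: trivial_words word_eval face_eval)

lemma edge_2u_0_0: "edge (face 2 0 1) (face 3 0 2)"
  by (rule edge_of_chain[where ms = "[((2, 1, 2), [], [R, S'], []),
      ((1, 1, 1), [], [B], [])]"])
    (simp add: face_eval, rule word_eq_reduce, simp add: word_eval face_eval)

lemma edge_2u_1_1: "edge (face 2 1 1) (face 3 1 2)"
  by (rule edge_of_chain[where ms = "[((2, 1, 2), [U'], [U, S', B], []),
      ((1, 1, 1), [], [B], [])]"])
    (simp add: face_eval, rule word_eq_conj_prod[of "[([R, S'], [B, B], False)]"],
      simp_all add: trivial_words word_eval face_eval)

lemma edge_2u_1_2: "edge (face 2 1 1) (face 3 2 2)"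
  by (rule edge_of_chain[where ms = "[((1, 1, 1), [A', U'], [A, U, S', B, S, R'], []),
      ((1, 1, 1), [], [R], [A', U'])]"])
    (simp add: face_eval, rule word_eq_conj_prod[of "[([A, U, S', B, S, R', U, A, S', B', S, U', A'], [A, U, A', U'], False),
      ([A, U, S', B, S, R'], [U, A, S', B, S, R', U, A, S', B, S, R'], True),
      ([A, U, A', U', R, S'], [B, B], False),
      ([], [A, U, A', U'], True)]"],
      simp_all add: trivial_words word_eval face_eval)

section \<open>Translations\<close>

lemma word_eq_commute_replicate:
  "word_eq Rels [x, y] [y, x] \<Longrightarrow> word_eq Rels ([x] @ replicate n y) (replicate n y @ [x])"
proof (induction n)
  case (Suc n)
  have "word_eq Rels ([x, y] @ replicate n y) ([y, x] @ replicate n y)"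
    using Suc.prems by (rule word_eq_append) simp
  also have "word_eq Rels \<dots> ([y] @ replicate n y @ [x])"
    using word_eq_append[OF word_eq_refl Suc.IH[OF Suc.prems], of "[y]"] by simp
  finally show ?case by simp
qed simp

abbreviation letter_power :: "'g \<Rightarrow> int \<Rightarrow> 'g letter list" where
  "letter_power x k \<equiv> (if 0 \<le> k then replicate (nat k) (Gen x) else replicate (nat (- k)) (Inv x))"

lemma letter_power_Suc: "word_eq Rels (Gen x # letter_power x k) (letter_power x (k + 1))"
proof (cases "0 \<le> k")
  case True
  then show ?thesis by (simp add: nat_add_distrib)
next
  case False
  define n where "n = nat (- k - 1)"
  with False have k: "k = - int n - 1" by simp
  have "nat (- k) = Suc n" using k by simp
  moreover have "letter_power x (k + 1) = replicate n (Inv x)"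
    using k by auto
  moreover have "word_eq Rels ([Gen x, Inv x] @ replicate n (Inv x)) ([] @ replicate n (Inv x))"
    by (intro word_eq_append word_eq_reduce word_eq_refl) (simp add: reduce_def)
  ultimately show ?thesis using False by simp
qed

lemma letter_power_pred: "word_eq Rels (Inv x # letter_power x k) (letter_power x (k - 1))"
proof -
  have "word_eq Rels ([Inv x] @ letter_power x k) ([Inv x] @ Gen x # letter_power x (k - 1))"
    using letter_power_Suc[of Rels x "k - 1"]
    by (intro word_eq_append word_eq_refl) (simp add: word_eq_def)
  also have "word_eq Rels ([Inv x] @ Gen x # letter_power x (k - 1))
      ([Inv x, Gen x] @ letter_power x (k - 1))" by simp
  also have "word_eq Rels \<dots> ([] @ letter_power x (k - 1))"
    by (intro word_eq_append word_eq_reduce word_eq_refl) (simp add: reduce_def)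
  finally show ?thesis by simp
qed

lemma translation_eq: "translation k l = letter_power gA k @ letter_power gU l"
  by (simp add: translation_def)

lemma commute_letters: "[U, A] \<doteq> [A, U]" "[U, A'] \<doteq> [A', U]" "[U', A] \<doteq> [A, U']" "[U', A'] \<doteq> [A', U']"
  by (rule word_eq_conj_prod[of "[([], [A, U, A', U'], False)]"]
      word_eq_conj_prod[of "[([A'], [A, U, A', U'], True)]"]
      word_eq_conj_prod[of "[([U'], [A, U, A', U'], True)]"]
      word_eq_conj_prod[of "[([U', A'], [A, U, A', U'], False)]"];
      simp add: trivial_words word_eval; fail)+

lemma letter_translation:
  "A # translation k l \<doteq> translation (k + 1) l"
  "A' # translation k l \<doteq> translation (k - 1) l"
  "U # translation k l \<doteq> translation k (l + 1)"
  "U' # translation k l \<doteq> translation k (l - 1)"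
proof -
  have move: "x # letter_power gA k @ letter_power gU l \<doteq> letter_power gA k @ m"
    if "[x, A] \<doteq> [A, x]" "[x, A'] \<doteq> [A', x]" "x # letter_power gU l \<doteq> m" for x m
  proof -
    have "[x] @ letter_power gA k \<doteq> letter_power gA k @ [x]"
      using word_eq_commute_replicate that(1,2) by auto
    then have "([x] @ letter_power gA k) @ letter_power gU l \<doteq> (letter_power gA k @ [x]) @ letter_power gU l"
      by (rule weq_append_right)
    also have "(letter_power gA k @ [x]) @ letter_power gU l \<doteq> letter_power gA k @ m"
      using weq_append_left[OF that(3), of "letter_power gA k"] by simp
    finally show ?thesis by simp
  qed
  show "A # translation k l \<doteq> translation (k + 1) l"
    using weq_append_right[OF letter_power_Suc, of gA k "letter_power gU l"]
    unfolding translation_eq by simp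
  show "A' # translation k l \<doteq> translation (k - 1) l"
    using weq_append_right[OF letter_power_pred, of gA k "letter_power gU l"]
    unfolding translation_eq by simp
  show "U # translation k l \<doteq> translation k (l + 1)"
    unfolding translation_eq by (rule move[OF commute_letters(1,2) letter_power_Suc])
  show "U' # translation k l \<doteq> translation k (l - 1)"
    unfolding translation_eq by (rule move[OF commute_letters(3,4) letter_power_pred])
qed

lemma parabolic_weq_translation: "parabolic p \<Longrightarrow> \<exists>k l. p \<doteq> translation k l"
proof (induction p)
  case Nil
  have "[] = translation 0 0" by (simp add: translation_def)
  then show ?case by (metis word_eq_refl)
next
  case (Cons x p)
  then obtain k l where "p \<doteq> translation k l" by auto
  then have "x # p \<doteq> x # translation k l"
    using weq_append_left[of p "translation k l" "[x]"] by simp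
  moreover have "\<exists>k' l'. x # translation k l \<doteq> translation k' l'"
    using Cons.prems letter_translation[of k l] by auto
  ultimately show ?case using word_eq_trans by blast
qed

lemma parabolic_translation: "parabolic (translation k l)"
  by (auto simp: translation_def parabolic_def)

lemma word_col_replicate:
  "word_col (replicate n A) (a, b, c, d) = (a + n * c, b + n * d, c, d)"
  "word_col (replicate n A') (a, b, c, d) = (a - n * c, b - n * d, c, d)"
  "word_col (replicate n U) (a, b, c, d) = (a - 11 * n * d, b + n * (c + d), c, d)"
  "word_col (replicate n U') (a, b, c, d) = (a + 11 * n * d, b - n * (c + d), c, d)"
  by (induction n) (simp_all add: algebra_simps)

lemma word_col_translation:
  "word_col (translation k l) (a, b, c, d) = (a + k * c - 11 * l * d, b + k * d + l * (c + d), c, d)"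
  by (simp add: translation_def word_col_replicate)

lemma translation_matrix: "word_matrix (translation k l) $ 1 $ 2 = zom k l"
  using word_col_correct[of "translation k l" 2] by (simp add: word_col_translation)

lemma zom_eq_iff: "zom a b = zom c d \<longleftrightarrow> a = c \<and> b = d"
proof
  assume *: "zom a b = zom c d"
  have "Im (zom a b) = Im (zom c d)" "Re (zom a b) = Re (zom c d)" using * by simp_all
  then show "a = c \<and> b = d" by (simp add: zom_def Re_Im_omega)
qed simp

lemma parabolic_eqI:
  assumes "parabolic p" "parabolic q" "word_matrix p = word_matrix q \<or> word_matrix p = - word_matrix q"
  shows "p \<doteq> q"
proof -
  obtain k l k' l' where p: "p \<doteq> translation k l" and q: "q \<doteq> translation k' l'"
    using parabolic_weq_translation assms(1,2) by blast
  have "word_matrix (translation k l) = word_matrix (translation k' l')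
      \<or> word_matrix (translation k l) = - word_matrix (translation k' l')"
    using assms(3) weq_word_matrix[OF p] weq_word_matrix[OF q] by (metis minus_minus)
  \<comment> \<open>The upper left entry is 1 on both sides, which excludes the minus sign.\<close>
  moreover have "word_matrix (translation k l) \<noteq> - word_matrix (translation k' l')"
    using parabolic_matrix[OF parabolic_translation] by (auto simp: vec_eq_iff forall_2)
  ultimately have "zom k l = zom k' l'"
    using translation_matrix by metis
  then have "translation k l = translation k' l'"
    by (simp add: zom_eq_iff)
  then show ?thesis
    using p q by (simp add: word_eq_def)
qed

lemma translation_append: "translation a b @ translation k l \<doteq> translation (k + a) (l + b)"
proof (rule parabolic_eqI)
  have *: "zom (k + a) (l + b) = zom k l + zom a b"
    by (simp add: zom_def algebra_simps)
  have "word_matrix (translation a b @ translation k l) = word_matrix (translation (k + a) (l + b))"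
    using parabolic_matrix[OF parabolic_translation]
    by (simp add: word_matrix_append vec_eq_iff forall_2 matrix_mult_2_entry translation_matrix *)
  then show "word_matrix (translation a b @ translation k l) = word_matrix (translation (k + a) (l + b))
      \<or> word_matrix (translation a b @ translation k l) = - word_matrix (translation (k + a) (l + b))" ..
qed (simp_all add: parabolic_translation)

section \<open>Adjacency of all faces\<close>

lemma edge_shift:
  assumes "edge (face s k l) (face s' k' l')" "s \<noteq> 0" "s' \<noteq> 0"
  shows "edge (face s (k + a * s) (l + b * s)) (face s' (k' + a * s') (l' + b * s'))"
proof -
  have shift: "translation a b @ face s k l \<doteq> face s (k + a * s) (l + b * s)" if "s \<noteq> 0" for s k l
    using that weq_append_right[OF translation_append, of a b "k div s" "l div s"]
    by (simp add: face_def add.commute)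
  show ?thesis
    by (rule edge_cong[OF edge_append_left[OF assms(1) parabolic_translation]
          shift[OF assms(2)] shift[OF assms(3)]])
qed

text \<open>For \<open>s\<close> = 2 or 3 dividing \<open>l\<close>, the centre either has
  denominator 1 or lies between two neighbouring centres of a row with \<open>s\<close> = 1, whose
  unit discs cover the smaller disc. Such rows contribute nothing to the covering.\<close>

definition face_row :: "int \<Rightarrow> int \<Rightarrow> bool" where
  "face_row s l \<longleftrightarrow> s = 1 \<or> s = 2 \<and> odd l \<or> s = 3 \<and> \<not> 3 dvd l"

lemma face_row_pos: "face_row s l \<Longrightarrow> 0 < s"
  by (auto simp: face_row_def)

lemma edge_row:
  assumes "face_row s l"
  shows "edge (face s k l) (face s (k + 1) l)"
proof -
  have s: "s \<noteq> 0" using face_row_pos[OF assms] by simp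
  have "edge (face s (k mod s) (l mod s)) (face s (k mod s + 1) (l mod s))"
  proof (cases "s = 1")
    case True
    then show ?thesis using edge_row1_0_0 by simp
  next
    case False
    show ?thesis
    proof (cases "s = 2")
      case True
      moreover have "l mod 2 = 1" using assms True by (auto simp: face_row_def odd_iff_mod_2_eq_one)
      moreover have "k mod 2 = 0 \<or> k mod 2 = 1" by auto
      ultimately show ?thesis using edge_row2_0_1 edge_row2_1_1 by auto
    next
      case s2: False
      with assms \<open>s \<noteq> 1\<close> have "s = 3" "l mod 3 = 1 \<or> l mod 3 = 2" by (auto simp: face_row_def) presburger
      moreover have "k mod 3 = 0 \<or> k mod 3 = 1 \<or> k mod 3 = 2" by presburger
      ultimately show ?thesis
        using edge_row3_0_1 edge_row3_1_1 edge_row3_2_1 edge_row3_0_2 edge_row3_1_2 edge_row3_2_2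
        by auto
    qed
  qed
  from edge_shift[OF this s s, of "k div s" "l div s"] show ?thesis
    by (simp add: add.commute add.left_commute)
qed

text \<open>The centres differ horizontally by (k' - 3k + 1/2)/3, so the bounds allow a distance of
  at most 1/2, the half-width of the cell in which a unit disc is nearest in its row.\<close>

lemma edge_1u:
  assumes "-2 \<le> k' - 3 * k" "k' - 3 * k \<le> 1"
  shows "edge (face 1 k l) (face 3 k' (3 * l + 1))"
proof -
  have "k' - 3 * k \<in> {-2, -1, 0, 1}" using assms by auto
  then have "edge (face 1 0 0) (face 3 (k' - 3 * k) 1)"
    using edge_1u_0_m2 edge_1u_0_m1 edge_1u_0_0 edge_1u_0_1 by auto
  from edge_shift[OF this, of k l] show ?thesis by (simp add: algebra_simps)
qed

lemma edge_1d:
  assumes "-1 \<le> k' - 3 * k" "k' - 3 * k \<le> 2"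
  shows "edge (face 1 k l) (face 3 k' (3 * l - 1))"
proof -
  have "k' - 3 * k \<in> {-1, 0, 1, 2}" using assms by auto
  then have "edge (face 1 0 0) (face 3 (k' - 3 * k) (-1))"
    using edge_1d_0_m1 edge_1d_0_0 edge_1d_0_1 edge_1d_0_2 by auto
  from edge_shift[OF this, of k l] show ?thesis by (simp add: algebra_simps)
qed

text \<open>Here the horizontal difference of the centres is (2k' - 3k - 1/2)/6, so the bounds allow
  at most 1/4, again half the spacing of the centres with denominator 2. In \<open>edge_2u\<close>
  the summand -1/2 becomes 1/2.\<close>

lemma edge_2d:
  assumes "-1 \<le> 2 * k' - 3 * k" "2 * k' - 3 * k \<le> 2"
  shows "edge (face 2 k (2 * l + 1)) (face 3 k' (3 * l + 1))"
proof -
  define a e where "a = k div 2" "e = k mod 2"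
  have k: "k = e + a * 2" by (simp add: a_e_def)
  have "e = 0 \<and> k' - 3 * a \<in> {0, 1} \<or> e = 1 \<and> k' - 3 * a \<in> {1, 2}"
    using assms a_e_def(2) unfolding k by auto
  then have "edge (face 2 e 1) (face 3 (k' - 3 * a) 1)"
    using edge_2d_0_0 edge_2d_0_1 edge_2d_1_1 edge_2d_1_2 by auto
  from edge_shift[OF this, of a l] show ?thesis by (simp add: k algebra_simps)
qed

lemma edge_2u:
  assumes "-2 \<le> 2 * k' - 3 * k" "2 * k' - 3 * k \<le> 1"
  shows "edge (face 2 k (2 * l + 1)) (face 3 k' (3 * l + 2))"
proof -
  define a e where "a = k div 2" "e = k mod 2"
  have k: "k = e + a * 2" by (simp add: a_e_def)
  have "e = 0 \<and> k' - 3 * a \<in> {-1, 0} \<or> e = 1 \<and> k' - 3 * a \<in> {1, 2}"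
    using assms a_e_def(2) unfolding k by auto
  then have "edge (face 2 e 1) (face 3 (k' - 3 * a) 2)"
    using edge_2u_0_m1 edge_2u_0_0 edge_2u_1_1 edge_2u_1_2 by auto
  from edge_shift[OF this, of a l] show ?thesis by (simp add: k algebra_simps)
qed

section \<open>Discs around the face centres\<close>

text \<open>With \<open>z = x + iy\<surd>43/2\<close> this is \<open>|sz - (k + l\<omega>)|\<^sup>2\<close>.\<close>

definition excess :: "real \<Rightarrow> real \<Rightarrow> int \<Rightarrow> int \<Rightarrow> int \<Rightarrow> real" where
  "excess x y s k l = (s * x - k - l / 2)\<^sup>2 + 43 / 4 * (s * y - l)\<^sup>2"

lemma face0_col:
  assumes "face_row s l"
  shows "word_col (face0 s (k mod s) (l mod s)) (1, 0, 0, 0) = (k mod s, l mod s, s, 0) \<or>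
    word_col (face0 s (k mod s) (l mod s)) (1, 0, 0, 0) = (- (k mod s), - (l mod s), - s, 0)"
proof -
  have "s = 1 \<or> s = 2 \<and> l mod 2 = 1 \<or> s = 3 \<and> (l mod 3 = 1 \<or> l mod 3 = 2)"
    using assms by (auto simp: face_row_def odd_iff_mod_2_eq_one) presburger+
  moreover have "k mod 2 = 0 \<or> k mod 2 = 1" "k mod 3 = 0 \<or> k mod 3 = 1 \<or> k mod 3 = 2"
    by presburger+
  ultimately show ?thesis by (auto simp: face0_def)
qed

lemma face_col:
  assumes "face_row s l"
  shows "word_col (face s k l) (1, 0, 0, 0) = (k, l, s, 0) \<or>
    word_col (face s k l) (1, 0, 0, 0) = (- k, - l, - s, 0)"
proof -
  have "k mod s + k div s * s = k" "l mod s + l div s * s = l"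
    by (simp_all add: mult.commute)
  then show ?thesis
    using face0_col[OF assms, of k]
    by (auto simp: face_def word_col_translation algebra_simps)
qed

text \<open>The factor \<open>c\<close> comes out of the linear form, and the undetermined sign of
  the column vanishes in the norm. Thus a face is low exactly if the excess at z = -d/c is below
  1.\<close>

lemma height_face:
  assumes "face_row s l" "c \<noteq> 0"
  shows "height c d (face s k l) =
    (cmod c)\<^sup>2 * excess (Re (- d / c)) (2 * Im (- d / c) / sqrt 43) s k l"
proof -
  define z where "z = - d / c"
  have d: "d = - (c * z)" using assms(2) by (simp add: z_def)
  have "height c d (face s k l) = (cmod (c * zom k l + d * of_int s))\<^sup>2"
  proof -
    have "(word_matrix (face s k l) $ 1 $ 1 = zom k l \<and> word_matrix (face s k l) $ 2 $ 1 = of_int s) \<or>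
      (word_matrix (face s k l) $ 1 $ 1 = - zom k l \<and> word_matrix (face s k l) $ 2 $ 1 = - of_int s)"
      using face_col[OF assms(1), of k] word_col_correct[of "face s k l" 1]
      by (auto simp: zom_def)
    then show ?thesis
      unfolding height_def
      by (metis (no_types) minus_add_distrib mult_minus_right norm_minus_cancel)
  qed
  also have "c * zom k l + d * of_int s = c * (zom k l - of_int s * z)"
    by (simp add: d algebra_simps)
  also have "(cmod \<dots>)\<^sup>2 = (cmod c)\<^sup>2 * (cmod (zom k l - of_int s * z))\<^sup>2"
    by (simp add: norm_mult power_mult_distrib)
  also have "(cmod (zom k l - of_int s * z))\<^sup>2 = excess (Re z) (2 * Im z / sqrt 43) s k l"
  proof -
    have "Im z = 2 * Im z / sqrt 43 * (sqrt 43 / 2)" by simp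
    then obtain y where y: "2 * Im z / sqrt 43 = y" "Im z = y * (sqrt 43 / 2)" by blast
    have re: "Re (zom k l - of_int s * z) = - (s * Re z - k - l / 2)"
      and im: "Im (zom k l - of_int s * z) = - (sqrt 43 / 2 * (s * y - l))"
      by (simp_all add: zom_def Re_Im_omega y(2) field_simps)
    show ?thesis
      unfolding cmod_power2 y(1) excess_def re im power2_minus power_mult_distrib power_divide by simp
  qed
  finally show ?thesis by (simp add: z_def)
qed

text \<open>Within a row only the distance to a real number \<open>a\<close> varies, and an index
  between two others cannot be farther from \<open>a\<close> than both. Hence the discs of one row
  that contain z form an interval.\<close>

lemma excess_step:
  assumes "excess x y s k l \<le> 1" "excess x y s k' l < 1" "k < j \<and> j \<le> k' \<or> k' \<le> j \<and> j < k"
  shows "excess x y s j l < 1"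
proof -
  define a where "a = s * x - l / 2"
  have *: "excess x y s i l = (a - i)\<^sup>2 + 43 / 4 * (s * y - l)\<^sup>2" for i
    by (simp add: excess_def a_def algebra_simps)
  have "(a - j)\<^sup>2 \<le> (a - k')\<^sup>2 \<or> (a - j)\<^sup>2 < (a - k)\<^sup>2"
  proof -
    have "\<bar>a - j\<bar> \<le> \<bar>a - k'\<bar> \<or> \<bar>a - j\<bar> < \<bar>a - k\<bar>" using assms(3) by auto
    then show ?thesis by (meson abs_le_square_iff abs_ge_zero power2_le_imp_le not_le)
  qed
  then show ?thesis using assms(1,2) unfolding * by linarith
qed

text \<open>A closed condition: z may lie halfway between two centres, and then both are
  nearest.\<close>

definition nearest :: "real \<Rightarrow> int \<Rightarrow> int \<Rightarrow> int \<Rightarrow> bool" where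
  "nearest x s k l \<longleftrightarrow> \<bar>s * x - k - l / 2\<bar> \<le> 1 / 2"

lemma nearest_exists: "\<exists>k. nearest x s k l"
  by (intro exI[of _ "round (s * x - l / 2)"])
    (use of_int_round_abs_le[of "s * x - l / 2"] in \<open>simp add: nearest_def abs_minus_commute algebra_simps\<close>)

lemma nearest_excess:
  assumes "nearest x s k l"
  shows "excess x y s k l \<le> excess x y s k' l"
proof (cases "k' = k")
  case False
  then have "1 \<le> \<bar>real_of_int k' - real_of_int k\<bar>"
    by (metis of_int_diff of_int_abs of_int_1_le_iff zero_less_abs_iff int_one_le_iff_zero_less right_minus_eq)
  then have "\<bar>s * x - k - l / 2\<bar> \<le> \<bar>s * x - k' - l / 2\<bar>"
    using assms unfolding nearest_def by linarith
  then show ?thesis by (simp add: excess_def abs_le_square_iff)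
qed simp

text \<open>The numbers 264/1000 and 306/1000 below approximate \<open>\<surd>(3/43)\<close> from below and \<open>\<surd>(4/43)\<close> from above.
  These are the values of \<open>|sy - l|\<close> where the boundary of a disc meets the vertical lines at distance
  \<open>1/(2s)\<close> from its centre and where it is highest.\<close>

lemma excess_bound:
  assumes "excess x y s k l \<le> 1"
  shows "\<bar>s * y - l\<bar> < 306 / 1000"
proof (rule ccontr)
  assume "\<not> \<bar>s * y - l\<bar> < 306 / 1000"
  then have "(306 / 1000)\<^sup>2 \<le> (s * y - l)\<^sup>2" by (simp flip: abs_le_square_iff)
  moreover have "0 \<le> (s * x - k - l / 2)\<^sup>2" by simp
  moreover have "1 < 43 / 4 * (306 / 1000 :: real)\<^sup>2" by (simp add: power2_eq_square)
  ultimately show False using assms unfolding excess_def by linarith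
qed

lemma nearest_low:
  assumes "nearest x s k l" "\<bar>s * y - l\<bar> \<le> 264 / 1000"
  shows "excess x y s k l < 1"
proof -
  have "(s * x - k - l / 2)\<^sup>2 \<le> (1 / 2)\<^sup>2" "(s * y - l)\<^sup>2 \<le> (264 / 1000)\<^sup>2"
    using assms by (simp_all add: nearest_def flip: abs_le_square_iff)
  moreover have "(1 / 2)\<^sup>2 + 43 / 4 * (264 / 1000)\<^sup>2 < (1 :: real)" by (simp add: power2_eq_square)
  ultimately show ?thesis unfolding excess_def by linarith
qed

lemma nearest_boundary:
  assumes "nearest x s k l" "\<not> excess x y s k l < 1"
  shows "264 / 1000 < \<bar>s * y - l\<bar>"
  using nearest_low assms by force

section \<open>Faces below a given vertex\<close>

text \<open>Ordered by \<open>l / s\<close>, the denominators of the rows repeat as 1, 3, 2, 3.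
  Hence every neighbouring pair contains exactly one row with denominator 3, here always put
  second.\<close>

definition next_row :: "int \<Rightarrow> int \<Rightarrow> int \<Rightarrow> int \<Rightarrow> bool" where
  "next_row s l s' l' \<longleftrightarrow> (\<exists>m.
     s = 1 \<and> l = m \<and> s' = 3 \<and> l' = 3 * m + 1 \<or> s = 1 \<and> l = m \<and> s' = 3 \<and> l' = 3 * m - 1 \<or>
     s = 2 \<and> l = 2 * m + 1 \<and> s' = 3 \<and> l' = 3 * m + 1 \<or>
     s = 2 \<and> l = 2 * m + 1 \<and> s' = 3 \<and> l' = 3 * m + 2)"

lemma nearest_iff: "nearest x s k l \<longleftrightarrow> s * x - l / 2 - 1 / 2 \<le> k \<and> k \<le> s * x - l / 2 + 1 / 2"
  unfolding nearest_def by linarith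

text \<open>At ties a row has two nearest centres, and not every pair of nearest centres is covered
  by the edges above; so \<open>k'\<close> has to be chosen to fit the given
  \<open>k\<close>.\<close>

lemma next_row_up:
  assumes "next_row s l s' l'" "nearest x s k l"
  shows "\<exists>k'. nearest x s' k' l' \<and> edge (face s k l) (face s' k' l')"
proof -
  from assms(1) obtain m where
    "s = 1 \<and> l = m \<and> s' = 3 \<and> l' = 3 * m + 1 \<or> s = 1 \<and> l = m \<and> s' = 3 \<and> l' = 3 * m - 1 \<or>
     s = 2 \<and> l = 2 * m + 1 \<and> s' = 3 \<and> l' = 3 * m + 1 \<or>
     s = 2 \<and> l = 2 * m + 1 \<and> s' = 3 \<and> l' = 3 * m + 2" unfolding next_row_def by blast
  \<comment> \<open>As Re \<omega> = 1/2, translation by m\<omega> shifts a row horizontally by m/2;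
    this is undone here.\<close>
  moreover define t where "t = x - m / 2"
  then have x: "x = t + m / 2" by simp
  ultimately consider
    (1) "s = 1" "l = m" "s' = 3" "l' = 3 * m + 1" | (2) "s = 1" "l = m" "s' = 3" "l' = 3 * m - 1"
    | (3) "s = 2" "l = 2 * m + 1" "s' = 3" "l' = 3 * m + 1"
    | (4) "s = 2" "l = 2 * m + 1" "s' = 3" "l' = 3 * m + 2" by blast
  then show ?thesis
  proof cases
    case 1
    let ?k = "\<lfloor>3 * t\<rfloor>"
    have k: "t - 1 / 2 \<le> k" "k \<le> t + 1 / 2" using assms(2) by (simp_all add: nearest_iff 1 x)
    have f: "?k \<le> 3 * t" "3 * t < ?k + 1" by linarith+
    have "-3 < real_of_int (?k - 3 * k)" "real_of_int (?k - 3 * k) < 2" using k f by linarith+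
    then have "-2 \<le> ?k - 3 * k" "?k - 3 * k \<le> 1" by linarith+
    then have "edge (face 1 k m) (face 3 ?k (3 * m + 1))" by (rule edge_1u)
    moreover have "nearest x 3 ?k (3 * m + 1)" using f by (simp add: nearest_iff x field_simps)
    ultimately show ?thesis unfolding 1 by blast
  next
    case 2
    let ?k = "\<lceil>3 * t\<rceil>"
    have k: "t - 1 / 2 \<le> k" "k \<le> t + 1 / 2" using assms(2) by (simp_all add: nearest_iff 2 x)
    have f: "?k - 1 < 3 * t" "3 * t \<le> ?k" by linarith+
    have "-2 < real_of_int (?k - 3 * k)" "real_of_int (?k - 3 * k) < 3" using k f by linarith+
    then have "-1 \<le> ?k - 3 * k" "?k - 3 * k \<le> 2" by linarith+
    then have "edge (face 1 k m) (face 3 ?k (3 * m - 1))" by (rule edge_1d)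
    moreover have "nearest x 3 ?k (3 * m - 1)" using f by (simp add: nearest_iff x field_simps)
    ultimately show ?thesis unfolding 2 by blast
  next
    case 3
    have k: "2 * t - 1 \<le> k" "k \<le> 2 * t" using assms(2) by (simp_all add: nearest_iff 3 x field_simps)
    obtain j :: int where j: "j \<le> 3 * t" "3 * t \<le> j + 1" "-1 \<le> 2 * j - 3 * k" "2 * j - 3 * k \<le> 2"
    proof -
      define i where "i = \<lfloor>3 * t\<rfloor>"
      have f: "i \<le> 3 * t" "3 * t < i + 1" unfolding i_def by linarith+
      have "-2 < real_of_int (2 * i - 3 * k)" "real_of_int (2 * i - 3 * k) \<le> 3" using k f by linarith+
      then have b: "-1 \<le> 2 * i - 3 * k" "2 * i - 3 * k \<le> 3" by linarith+
      show ?thesis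
      \<comment> \<open>The value 3 is outside the range of \<open>edge_2d\<close>. It forces 3t = i
        and 2t = k + 1, ties in both rows, and then \<open>i - 1\<close> is nearest too.\<close>
      proof (cases "2 * i - 3 * k = 3")
        case True
        then have "real_of_int (2 * i - 3 * k) = 3" by simp
        then have eq: "2 * real_of_int i = 6 * t" using k f by linarith
        then show ?thesis
          by (intro that[of "i - 1"]; (use eq in linarith | use True in presburger))
      next
        case False
        then show ?thesis using b f by (intro that[of i]) linarith+
      qed
    qed
    have "edge (face 2 k (2 * m + 1)) (face 3 j (3 * m + 1))" by (rule edge_2d[OF j(3,4)])
    moreover have "nearest x 3 j (3 * m + 1)" using j by (simp add: nearest_iff x field_simps)
    ultimately show ?thesis unfolding 3 by blast
  next
    case 4
    have k: "2 * t - 1 \<le> k" "k \<le> 2 * t" using assms(2) by (simp_all add: nearest_iff 4 x field_simps)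
    obtain j :: int where j: "j \<le> 3 * t - 1 / 2" "3 * t - 1 / 2 \<le> j + 1" "-2 \<le> 2 * j - 3 * k" "2 * j - 3 * k \<le> 1"
    proof -
      define i where "i = \<lfloor>3 * t - 1 / 2\<rfloor>"
      have f: "i \<le> 3 * t - 1 / 2" "3 * t - 1 / 2 < i + 1" unfolding i_def by linarith+
      have "-3 < real_of_int (2 * i - 3 * k)" "real_of_int (2 * i - 3 * k) \<le> 2" using k f by linarith+
      then have b: "-2 \<le> 2 * i - 3 * k" "2 * i - 3 * k \<le> 2" by linarith+
      show ?thesis
      proof (cases "2 * i - 3 * k = 2")
        case True
        then have "real_of_int (2 * i - 3 * k) = 2" by simp
        then have eq: "2 * real_of_int i = 6 * t - 1" using k f by linarith
        then show ?thesis
          by (intro that[of "i - 1"]; (use eq in linarith | use True in presburger))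
      next
        case False
        then show ?thesis using b f by (intro that[of i]) linarith+
      qed
    qed
    have "edge (face 2 k (2 * m + 1)) (face 3 j (3 * m + 2))" by (rule edge_2u[OF j(3,4)])
    moreover have "nearest x 3 j (3 * m + 2)" using j by (simp add: nearest_iff x field_simps)
    ultimately show ?thesis unfolding 4 by blast
  qed
qed

text \<open>Does not follow from \<open>next_row_up\<close>: starting from a nearest centre below,
  that lemma may reach the other of two tied centres instead of the given \<open>k'\<close>.\<close>

lemma next_row_down:
  assumes "next_row s l s' l'" "nearest x s' k' l'"
  shows "\<exists>k. nearest x s k l \<and> edge (face s k l) (face s' k' l')"
proof -
  from assms(1) obtain m where
    "s = 1 \<and> l = m \<and> s' = 3 \<and> l' = 3 * m + 1 \<or> s = 1 \<and> l = m \<and> s' = 3 \<and> l' = 3 * m - 1 \<or>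
     s = 2 \<and> l = 2 * m + 1 \<and> s' = 3 \<and> l' = 3 * m + 1 \<or>
     s = 2 \<and> l = 2 * m + 1 \<and> s' = 3 \<and> l' = 3 * m + 2" unfolding next_row_def by blast
  moreover define t where "t = x - m / 2"
  then have x: "x = t + m / 2" by simp
  ultimately consider
    (1) "s = 1" "l = m" "s' = 3" "l' = 3 * m + 1" | (2) "s = 1" "l = m" "s' = 3" "l' = 3 * m - 1"
    | (3) "s = 2" "l = 2 * m + 1" "s' = 3" "l' = 3 * m + 1"
    | (4) "s = 2" "l = 2 * m + 1" "s' = 3" "l' = 3 * m + 2" by blast
  then show ?thesis
  proof cases
    case 1
    let ?k = "\<lfloor>t + 1 / 2\<rfloor>"
    have k: "3 * t - 1 \<le> k'" "k' \<le> 3 * t" using assms(2) by (simp_all add: nearest_iff 1 x field_simps)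
    have f: "?k \<le> t + 1 / 2" "t + 1 / 2 < ?k + 1" by linarith+
    have "-3 < real_of_int (k' - 3 * ?k)" "real_of_int (k' - 3 * ?k) < 2" using k f by linarith+
    then have "-2 \<le> k' - 3 * ?k" "k' - 3 * ?k \<le> 1" by linarith+
    then have "edge (face 1 ?k m) (face 3 k' (3 * m + 1))" by (rule edge_1u)
    moreover have "nearest x 1 ?k m" using f by (simp add: nearest_iff x field_simps)
    ultimately show ?thesis unfolding 1 by blast
  next
    case 2
    let ?k = "\<lfloor>t + 1 / 2\<rfloor>"
    have k: "3 * t \<le> k'" "k' \<le> 3 * t + 1" using assms(2) by (simp_all add: nearest_iff 2 x field_simps)
    have f: "?k \<le> t + 1 / 2" "t + 1 / 2 < ?k + 1" by linarith+
    have "-2 < real_of_int (k' - 3 * ?k)" "real_of_int (k' - 3 * ?k) < 3" using k f by linarith+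
    then have "-1 \<le> k' - 3 * ?k" "k' - 3 * ?k \<le> 2" by linarith+
    then have "edge (face 1 ?k m) (face 3 k' (3 * m - 1))" by (rule edge_1d)
    moreover have "nearest x 1 ?k m" using f by (simp add: nearest_iff x field_simps)
    ultimately show ?thesis unfolding 2 by blast
  next
    case 3
    have k: "3 * t - 1 \<le> k'" "k' \<le> 3 * t" using assms(2) by (simp_all add: nearest_iff 3 x field_simps)
    obtain j :: int where j: "j \<le> 2 * t" "2 * t \<le> j + 1" "-1 \<le> 2 * k' - 3 * j" "2 * k' - 3 * j \<le> 2"
    proof -
      define i where "i = \<lfloor>2 * t\<rfloor>"
      have f: "i \<le> 2 * t" "2 * t < i + 1" unfolding i_def by linarith+
      have "-2 \<le> real_of_int (2 * k' - 3 * i)" "real_of_int (2 * k' - 3 * i) < 3" using k f by linarith+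
      then have b: "-2 \<le> 2 * k' - 3 * i" "2 * k' - 3 * i \<le> 2" by linarith+
      show ?thesis
      proof (cases "2 * k' - 3 * i = -2")
        case True
        then have "real_of_int (2 * k' - 3 * i) = -2" by simp
        then have eq: "real_of_int i = 2 * t" using k f by linarith
        then show ?thesis
          by (intro that[of "i - 1"]; (use eq in linarith | use True in presburger))
      next
        case False
        then show ?thesis using b f by (intro that[of i]) linarith+
      qed
    qed
    have "edge (face 2 j (2 * m + 1)) (face 3 k' (3 * m + 1))" by (rule edge_2d[OF j(3,4)])
    moreover have "nearest x 2 j (2 * m + 1)" using j by (simp add: nearest_iff x field_simps)
    ultimately show ?thesis unfolding 3 by blast
  next
    case 4
    have k: "3 * t - 3 / 2 \<le> k'" "k' \<le> 3 * t - 1 / 2"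
      using assms(2) by (simp_all add: nearest_iff 4 x field_simps)
    obtain j :: int where j: "j \<le> 2 * t" "2 * t \<le> j + 1" "-2 \<le> 2 * k' - 3 * j" "2 * k' - 3 * j \<le> 1"
    proof -
      define i where "i = \<lfloor>2 * t\<rfloor>"
      have f: "i \<le> 2 * t" "2 * t < i + 1" unfolding i_def by linarith+
      have "-3 \<le> real_of_int (2 * k' - 3 * i)" "real_of_int (2 * k' - 3 * i) < 2" using k f by linarith+
      then have b: "-3 \<le> 2 * k' - 3 * i" "2 * k' - 3 * i \<le> 1" by linarith+
      show ?thesis
      proof (cases "2 * k' - 3 * i = -3")
        case True
        then have "real_of_int (2 * k' - 3 * i) = -3" by simp
        then have eq: "real_of_int i = 2 * t" using k f by linarith
        then show ?thesis
          by (intro that[of "i - 1"]; (use eq in linarith | use True in presburger))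
      next
        case False
        then show ?thesis using b f by (intro that[of i]) linarith+
      qed
    qed
    have "edge (face 2 j (2 * m + 1)) (face 3 k' (3 * m + 2))" by (rule edge_2u[OF j(3,4)])
    moreover have "nearest x 2 j (2 * m + 1)" using j by (simp add: nearest_iff x field_simps)
    ultimately show ?thesis unfolding 4 by blast
  qed
qed

lemma next_row_rows: "next_row s l s' l' \<Longrightarrow> face_row s l \<and> face_row s' l'"
  by (auto simp: next_row_def face_row_def) presburger+

text \<open>A disc of the row at \<open>l / s\<close> stays within 0.306/s of that level. Between
  levels 0 and 1 the rows with denominators 1, 3, 2, 3, 1 thus occupy about [0, 0.306],
  [0.231, 0.435], [0.347, 0.653], [0.565, 0.769] and [0.694, 1], where only neighbours
  overlap.\<close>

lemma rows_near:
  fixes y :: real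
  assumes "face_row s l" "face_row s' l'" "\<bar>s * y - l\<bar> < 306 / 1000" "\<bar>s' * y - l'\<bar> < 306 / 1000"
  shows "s = s' \<and> l = l' \<or> next_row s l s' l' \<or> next_row s' l' s l"
proof -
  have 13: "next_row 1 l 3 l'" if "face_row 3 l'" "\<bar>y - l\<bar> < 306 / 1000" "\<bar>3 * y - l'\<bar> < 306 / 1000" for l l'
  proof -
    have "-2 < real_of_int (l' - 3 * l)" "real_of_int (l' - 3 * l) < 2" using that(2,3) by linarith+
    then have "l' - 3 * l = -1 \<or> l' - 3 * l = 0 \<or> l' - 3 * l = 1" by linarith
    moreover have "l' \<noteq> 3 * l" using that(1) by (auto simp: face_row_def)
    ultimately show ?thesis by (auto simp: next_row_def)
  qed
  have 23: "next_row 2 l 3 l'" if "face_row 2 l" "\<bar>2 * y - l\<bar> < 306 / 1000" "\<bar>3 * y - l'\<bar> < 306 / 1000" for l l'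
  proof -
    have "-2 < real_of_int (3 * l - 2 * l')" "real_of_int (3 * l - 2 * l') < 2" using that(2,3) by linarith+
    then have "-2 < 3 * l - 2 * l'" "3 * l - 2 * l' < 2" by linarith+
    moreover have "odd l" using that(1) by (auto simp: face_row_def)
    then obtain m where m: "l = 2 * m + 1" by (rule oddE)
    ultimately have "l' = 3 * m + 1 \<or> l' = 3 * m + 2" by presburger
    then show ?thesis using m by (auto simp: next_row_def)
  qed
  have 12: False if "face_row 2 l'" "\<bar>y - l\<bar> < 306 / 1000" "\<bar>2 * y - l'\<bar> < 306 / 1000" for l l' :: int
  proof -
    have "-1 < real_of_int (l' - 2 * l)" "real_of_int (l' - 2 * l) < 1" using that(2,3) by linarith+
    then have "l' = 2 * l" by linarith
    then show False using that(1) by (auto simp: face_row_def)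
  qed
  have same: "l = l'" if "s = s'"
  proof -
    have "-1 < real_of_int (l' - l)" "real_of_int (l' - l) < 1" using assms(3,4) unfolding that by linarith+
    then show "l = l'" by linarith
  qed
  have "next_row s l s' l'" if "s = 1" "s' = 3" using 13[of l' l] assms that by simp
  moreover have "next_row s' l' s l" if "s = 3" "s' = 1" using 13[of l l'] assms that by simp
  moreover have "next_row s l s' l'" if "s = 2" "s' = 3" using 23[of l l'] assms that by simp
  moreover have "next_row s' l' s l" if "s = 3" "s' = 2" using 23[of l' l] assms that by simp
  moreover have False if "s = 1" "s' = 2" using 12[of l' l] assms that by simp
  moreover have False if "s = 2" "s' = 1" using 12[of l l'] assms that by simp
  moreover have "s = 1 \<or> s = 2 \<or> s = 3" "s' = 1 \<or> s' = 2 \<or> s' = 3"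
    using assms(1,2) by (auto simp: face_row_def)
  ultimately show ?thesis using same by metis
qed

text \<open>The narrower bands still overlap: up to 0.264 for denominator 1, about [0.245, 0.421]
  for 3 and [0.368, 0.632] for 2. Any cut in the second overlap would do; 4/10 is used.\<close>

lemma row_exists:
  fixes y :: real
  obtains s l where "face_row s l" "\<bar>s * y - l\<bar> \<le> 264 / 1000"
proof -
  define m where "m = round y"
  define v where "v = y - m"
  have v: "\<bar>v\<bar> \<le> 1 / 2" using of_int_round_abs_le[of y] by (simp add: v_def m_def abs_minus_commute)
  have y: "y = v + m" by (simp add: v_def)
  consider "\<bar>v\<bar> \<le> 264 / 1000" | "264 / 1000 \<le> v" "v \<le> 4 / 10" | "4 / 10 \<le> v"
    | "v \<le> - 264 / 1000" "- 4 / 10 \<le> v" | "v \<le> - 4 / 10" by linarith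
  then show ?thesis
  proof cases
    case 1
    then show ?thesis by (intro that[of 1 m]) (simp_all add: face_row_def y)
  next
    case 2
    have "face_row 3 (3 * m + 1)" unfolding face_row_def by presburger
    moreover have "\<bar>3 * y - (3 * m + 1)\<bar> \<le> 264 / 1000" using 2 y by linarith
    ultimately show ?thesis by (intro that[of 3 "3 * m + 1"]) simp_all
  next
    case 3
    have "\<bar>2 * y - (2 * m + 1)\<bar> \<le> 264 / 1000" using 3 v y by linarith
    then show ?thesis by (intro that[of 2 "2 * m + 1"]) (simp_all add: face_row_def)
  next
    case 4
    have "face_row 3 (3 * m - 1)" unfolding face_row_def by presburger
    moreover have "\<bar>3 * y - (3 * m - 1)\<bar> \<le> 264 / 1000" using 4 y by linarith
    ultimately show ?thesis by (intro that[of 3 "3 * m - 1"]) simp_all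
  next
    case 5
    have "\<bar>2 * y - (2 * m - 1)\<bar> \<le> 264 / 1000" using 5 v y by linarith
    then show ?thesis by (intro that[of 2 "2 * m - 1"]) (simp_all add: face_row_def)
  qed
qed

text \<open>The thin strip where the nearest disc of one row can fail lies within the safe band of
  the adjacent row on the same side. For instance, from \<open>s\<close> = 1 upwards 3v - 1 is
  between -0.208 and -0.082.\<close>

lemma boundary_next_row:
  fixes y :: real
  assumes "face_row s l" "264 / 1000 < \<bar>s * y - l\<bar>" "\<bar>s * y - l\<bar> < 306 / 1000"
  obtains s' l' where "next_row s l s' l' \<or> next_row s' l' s l" "\<bar>s' * y - l'\<bar> \<le> 264 / 1000"
proof -
  define v where "v = s * y - l"
  have v: "264 / 1000 < v \<and> v < 306 / 1000 \<or> - 306 / 1000 < v \<and> v < - 264 / 1000"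
    using assms(2,3) unfolding v_def by linarith
  consider (1) "s = 1" | (2) m where "s = 2" "l = 2 * m + 1" | (3) m where "s = 3" "l = 3 * m + 1"
    | (4) m where "s = 3" "l = 3 * m + 2"
  proof -
    have "s = 3 \<Longrightarrow> \<not> 3 dvd l \<Longrightarrow> \<exists>m. l = 3 * m + 1 \<or> l = 3 * m + 2" by presburger
    then show ?thesis using assms(1) that by (auto simp: face_row_def elim: oddE)
  qed
  then show ?thesis
  proof cases
    case 1
    then have y: "y = v + l" by (simp add: v_def)
    show ?thesis
    proof (cases "0 < v")
      case True
      then show ?thesis using v 1 by (intro that[of 3 "3 * l + 1"]) (auto simp: next_row_def y)
    next
      case False
      then show ?thesis using v 1 by (intro that[of 3 "3 * l - 1"]) (auto simp: next_row_def y)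
    qed
  next
    case 2
    then have y: "y = v / 2 + m + 1 / 2" by (simp add: v_def field_simps)
    show ?thesis
    proof (cases "0 < v")
      case True
      then show ?thesis using v 2 by (intro that[of 3 "3 * m + 2"]) (auto simp: next_row_def y)
    next
      case False
      then show ?thesis using v 2 by (intro that[of 3 "3 * m + 1"]) (auto simp: next_row_def y)
    qed
  next
    case 3
    then have y: "y = v / 3 + m + 1 / 3" by (simp add: v_def field_simps)
    show ?thesis
    proof (cases "0 < v")
      case True
      then show ?thesis using v 3 by (intro that[of 2 "2 * m + 1"]) (auto simp: next_row_def y)
    next
      case False
      then show ?thesis using v 3 by (intro that[of 1 m]) (auto simp: next_row_def y)
    qed
  next
    case 4
    then have y: "y = v / 3 + m + 2 / 3" by (simp add: v_def field_simps)
    show ?thesis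
    proof (cases "0 < v")
      case True
      have "next_row 1 (m + 1) s l" using 4 by (auto simp: next_row_def)
      then show ?thesis using v True by (intro that[of 1 "m + 1"]) (auto simp: y)
    next
      case False
      then show ?thesis using v 4 by (intro that[of 2 "2 * m + 1"]) (auto simp: next_row_def y)
    qed
  qed
qed

lemma neighbour_row:
  assumes "next_row s l s' l' \<or> next_row s' l' s l" "nearest x s k l"
  obtains k' where "nearest x s' k' l'" "edge (face s k l) (face s' k' l')"
  using assms(1)
proof
  assume "next_row s l s' l'"
  from next_row_up[OF this assms(2)] show ?thesis using that by blast
next
  assume "next_row s' l' s l"
  from next_row_down[OF this assms(2)] obtain k' where
    "nearest x s' k' l'" "edge (face s' k' l') (face s k l)" by blast
  then show ?thesis using that[of k'] edge_sym[of "face s' k' l'"] by simp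
qed

section \<open>Low faces for a fixed bottom row\<close>

context
  fixes c d :: complex and zx zy :: real
  assumes c: "c \<noteq> 0" and zx: "zx = Re (- d / c)" and zy: "zy = 2 * Im (- d / c) / sqrt 43"
begin

lemma low_face_iff: "face_row s l \<Longrightarrow> low c d (face s k l) \<longleftrightarrow> excess zx zy s k l < 1"
  using c by (simp add: height_face[OF _ c, where d = d, folded zx zy])

lemma height_face_le_iff: "face_row s l \<Longrightarrow> height c d (face s k l) \<le> (cmod c)\<^sup>2 \<longleftrightarrow> excess zx zy s k l \<le> 1"
  using c by (simp add: height_face[OF _ c, where d = d, folded zx zy])

lemma edge_link:
  "edge u v \<Longrightarrow> height c d u \<le> (cmod c)\<^sup>2 \<Longrightarrow> low c d v \<Longrightarrow> link c d u v"
  by (simp add: edge_def)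

lemma edge_low_path: "edge u v \<Longrightarrow> low c d u \<Longrightarrow> low c d v \<Longrightarrow> (low_step c d)\<^sup>*\<^sup>* u v"
  by (rule link_imp_low_path[OF edge_link[OF _ less_imp_le]])

lemma low_path_in_row_le:
  assumes "face_row s l" "low c d (face s k l)" "low c d (face s (k + int n) l)"
  shows "(low_step c d)\<^sup>*\<^sup>* (face s k l) (face s (k + int n) l)"
  using assms(3)
proof (induction n)
  case (Suc n)
  have low: "low c d (face s (k + int n) l)"
  proof (cases "n = 0")
    case False
    then show ?thesis
      using excess_step[of zx zy s "k + int (Suc n)" l k "k + int n"] Suc.prems assms(1,2)
      by (simp add: low_face_iff)
  qed (use assms(2) in simp)
  moreover have "edge (face s (k + int n) l) (face s (k + int (Suc n)) l)"
    using edge_row[OF assms(1), of "k + int n"] by (simp add: algebra_simps)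
  ultimately have "(low_step c d)\<^sup>*\<^sup>* (face s (k + int n) l) (face s (k + int (Suc n)) l)"
    using Suc.prems by (intro edge_low_path)
  with Suc.IH[OF low] show ?case by (rule rtranclp_trans)
qed simp

lemma low_path_in_row:
  assumes "face_row s l" "low c d (face s k l)" "low c d (face s k' l)"
  shows "(low_step c d)\<^sup>*\<^sup>* (face s k l) (face s k' l)"
proof (cases "k \<le> k'")
  case True
  then show ?thesis using low_path_in_row_le[of s l k "nat (k' - k)"] assms by simp
next
  case False
  then have "(low_step c d)\<^sup>*\<^sup>* (face s k' l) (face s k l)"
    using low_path_in_row_le[of s l k' "nat (k - k')"] assms by simp
  then show ?thesis by (rule low_path_sym)
qed

text \<open>In each row a nearest face is low as soon as any face is. So a path can walk to a
  nearest face, cross to a matching nearest face of the other row, and walk on there.\<close>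

lemma low_faces_connected:
  assumes "face_row s l" "low c d (face s k l)" "face_row s' l'" "low c d (face s' k' l')"
  shows "(low_step c d)\<^sup>*\<^sup>* (face s k l) (face s' k' l')"
proof -
  have ex: "excess zx zy s k l < 1" "excess zx zy s' k' l' < 1"
    using assms by (simp_all add: low_face_iff)
  then have "\<bar>s * zy - l\<bar> < 306 / 1000" "\<bar>s' * zy - l'\<bar> < 306 / 1000"
    using excess_bound[OF less_imp_le[OF ex(1)]] excess_bound[OF less_imp_le[OF ex(2)]] by simp_all
  then consider "s = s'" "l = l'" | "next_row s l s' l' \<or> next_row s' l' s l"
    using rows_near[OF assms(1,3)] by blast
  then show ?thesis
  proof cases
    case 1
    then show ?thesis using low_path_in_row assms by simp
  next
    case 2
    obtain i where i: "nearest zx s i l" using nearest_exists by blast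
    obtain i' where i': "nearest zx s' i' l'" "edge (face s i l) (face s' i' l')"
      using neighbour_row[OF 2 i] by blast
    have "excess zx zy s i l < 1" "excess zx zy s' i' l' < 1"
      using nearest_excess[OF i, of zy k] nearest_excess[OF i'(1), of zy k'] ex by linarith+
    then have low: "low c d (face s i l)" "low c d (face s' i' l')"
      using low_face_iff[OF assms(1)] low_face_iff[OF assms(3)] by blast+
    have "(low_step c d)\<^sup>*\<^sup>* (face s k l) (face s i l)"
      using assms low by (intro low_path_in_row)
    also have "(low_step c d)\<^sup>*\<^sup>* (face s i l) (face s' i' l')"
      using i'(2) low by (rule edge_low_path)
    also have "(low_step c d)\<^sup>*\<^sup>* (face s' i' l') (face s' k' l')"
      using assms low by (intro low_path_in_row)
    finally show ?thesis .
  qed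
qed

lemma low_face_exists: "\<exists>s k l. face_row s l \<and> low c d (face s k l)"
proof -
  obtain s l where "face_row s l" "\<bar>s * zy - l\<bar> \<le> 264 / 1000" using row_exists .
  moreover obtain k where "nearest zx s k l" using nearest_exists by blast
  ultimately show ?thesis using nearest_low[of zx s k l zy] low_face_iff[of s l k] by blast
qed

text \<open>If the face is not nearest in its row, the adjacent centre towards z is strictly closer
  and hence low. If it is nearest, z is too far from the row's line, and a neighbouring row provides
  a low face.\<close>

lemma boundary_face_link:
  assumes "face_row s l" "height c d (face s k l) = (cmod c)\<^sup>2"
  shows "\<exists>s' k' l'. face_row s' l' \<and> low c d (face s' k' l') \<and> link c d (face s k l) (face s' k' l')"
proof -
  have ex: "excess zx zy s k l \<le> 1" "\<not> excess zx zy s k l < 1"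
    using assms(2) height_face_le_iff[OF assms(1), of k] low_face_iff[OF assms(1), of k] by auto
  show ?thesis
  proof (cases "nearest zx s k l")
    case True
    obtain s' l' where s': "next_row s l s' l' \<or> next_row s' l' s l" "\<bar>s' * zy - l'\<bar> \<le> 264 / 1000"
      using boundary_next_row[OF assms(1) nearest_boundary[OF True ex(2)] excess_bound[OF ex(1)]] .
    obtain k' where k': "nearest zx s' k' l'" "edge (face s k l) (face s' k' l')"
      using neighbour_row[OF s'(1) True] .
    have row': "face_row s' l'" using s'(1) next_row_rows by blast
    have low: "low c d (face s' k' l')"
      using nearest_low[OF k'(1) s'(2)] low_face_iff[OF row'] by blast
    show ?thesis
      using edge_link[OF k'(2) _ low] assms(2) row' low by auto
  next
    case False
    define j where "j = (if k < s * zx - l / 2 then k + 1 else k - 1)"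
    have "\<bar>s * zx - j - l / 2\<bar> < \<bar>s * zx - k - l / 2\<bar>"
      using False unfolding nearest_def j_def by auto
    from power_strict_mono[OF this abs_ge_zero, of 2]
    have "(s * zx - j - l / 2)\<^sup>2 < (s * zx - k - l / 2)\<^sup>2" by simp
    then have low: "low c d (face s j l)"
      using ex(1) assms(1) by (simp add: low_face_iff excess_def)
    have "edge (face s k l) (face s j l)"
      using edge_row[OF assms(1), of k] edge_sym[OF edge_row[OF assms(1), of "k - 1"]]
      by (simp add: j_def)
    then have "link c d (face s k l) (face s j l)"
      by (rule edge_link[OF _ _ low]) (simp add: assms(2))
    then show ?thesis using assms(1) low by blast
  qed
qed

end

section \<open>Descending words\<close>

lemma face0_in_faces:
  assumes "face_row s l"
  shows "face0 s (k mod s) (l mod s) \<in> faces"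
  by (simp add: face0_def faces_def)

lemma parabolic_faces_weq_face:
  assumes "parabolic p" "W \<in> faces"
  obtains s k l where "face_row s l" "p @ W \<doteq> face s k l"
proof -
  obtain a b where p: "p \<doteq> translation a b" using parabolic_weq_translation[OF assms(1)] by blast
  obtain s k l where W: "face_row s l" "0 \<le> k" "k < s" "0 \<le> l" "l < s" "W = face0 s k l"
  proof -
    have "\<exists>(s, k, l) \<in> {(1, 0, 0), (2, 0, 1), (2, 1, 1), (3, 0, 1), (3, 1, 1),
        (3, 2, 1), (3, 0, 2), (3, 1, 2), (3, 2, 2)}. W = face0 s k l"
      using assms(2) by (simp add: faces_def face0_def)
    then obtain s k l where skl: "(s, k, l) \<in> {(1, 0, 0), (2, 0, 1), (2, 1, 1), (3, 0, 1), (3, 1, 1),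
        (3, 2, 1), (3, 0, 2), (3, 1, 2), (3, 2, 2)}" and W: "W = face0 s k l" by (elim bexE case_prodE) simp
    show thesis by (rule that[OF _ _ _ _ _ W]) (use skl in \<open>auto simp: face_row_def\<close>)
  qed
  have "face_row s (l + b * s)" using W(1) by (auto simp: face_row_def)
  moreover have "p @ W \<doteq> face s (k + a * s) (l + b * s)"
    using weq_append_right[OF p, of W] W by (simp add: face_def)
  ultimately show thesis by (rule that)
qed

text \<open>The rule \<open>weq\<close> makes this a property of elements of the presented group
  rather than of words; strictness in \<open>step\<close> is what ties obstruct.\<close>

inductive descending :: "bianchi_gen letter list \<Rightarrow> bool" where
  base: "parabolic p \<Longrightarrow> descending p"
| step: "face_row s l \<Longrightarrow> ht (w @ face s k l) < ht w \<Longrightarrow> descending (w @ face s k l) \<Longrightarrow> descending w"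
| weq: "w \<doteq> w' \<Longrightarrow> descending w' \<Longrightarrow> descending w"

lemma parabolic_append_face:
  assumes "parabolic p" "face_row s l"
  obtains s' k' l' where "face_row s' l'" "p @ face s k l \<doteq> face s' k' l'"
proof -
  have "parabolic (p @ translation (k div s) (l div s))"
    using assms(1) parabolic_translation by simp
  from parabolic_faces_weq_face[OF this face0_in_faces[OF assms(2), of k]] show thesis
    using that by (auto simp: face_def)
qed

text \<open>The translation is absorbed by the face: a descent of \<open>w\<close> through f becomes
  one of \<open>w @ p\<close> through the inverse of \<open>p\<close> followed by f, which is again
  a face.\<close>

lemma descending_append_parabolic: "descending w \<Longrightarrow> parabolic p \<Longrightarrow> descending (w @ p)"
proof (induction rule: descending.induct)
  case (base q)
  then show ?case by (intro descending.base) simp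
next
  case (step s l w k)
  obtain s' k' l' where f: "face_row s' l'" "winv p @ face s k l \<doteq> face s' k' l'"
    using parabolic_append_face[OF parabolic_winv[OF step.prems] step.hyps(1)] .
  have "(w @ p) @ face s' k' l' \<doteq> (w @ p) @ (winv p @ face s k l)"
    by (rule weq_append_left[OF word_eq_sym[OF f(2)]])
  also have "\<dots> \<doteq> w @ face s k l"
  proof -
    have "w @ (p @ winv p) @ face s k l \<doteq> w @ [] @ face s k l"
      by (intro weq_append_left weq_append_right word_eq_reduce) (simp add: reduce_def[of "[]"])
    then show ?thesis by simp
  qed
  finally have *: "(w @ p) @ face s' k' l' \<doteq> w @ face s k l" .
  have "ht ((w @ p) @ face s' k' l') < ht (w @ p)"
    using ht_cong[OF *] step.hyps(2) ht_append_parabolic[OF step.prems, of w] by simp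
  then show ?case
    using descending.weq[OF * step.hyps(3)] by (rule descending.step[OF f(1)])
next
  case (weq w w')
  show ?case
    by (rule descending.weq[OF weq_append_right[OF weq.hyps(1)] weq.IH[OF weq.prems]])
qed

lemma descending_cases:
  "descending w \<Longrightarrow> (\<exists>p. parabolic p \<and> w \<doteq> p) \<or>
    (\<exists>s k l. face_row s l \<and> ht (w @ face s k l) < ht w \<and> descending (w @ face s k l))"
proof (induction rule: descending.induct)
  case (base p)
  then show ?case by blast
next
  case (step s l w k)
  then show ?case by blast
next
  case (weq w w')
  from weq.IH show ?case
  proof
    assume "\<exists>p. parabolic p \<and> w' \<doteq> p"
    then show ?thesis using word_eq_trans[OF weq.hyps(1)] by blast
  next
    assume "\<exists>s k l. face_row s l \<and> ht (w' @ face s k l) < ht w' \<and> descending (w' @ face s k l)"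
    then obtain s k l where f: "face_row s l" "ht (w' @ face s k l) < ht w'" "descending (w' @ face s k l)"
      by blast
    have eq: "w @ face s k l \<doteq> w' @ face s k l" by (rule weq_append_right[OF weq.hyps(1)])
    have "ht (w @ face s k l) < ht w" using f(2) ht_cong[OF weq.hyps(1)] ht_cong[OF eq] by simp
    moreover have "descending (w @ face s k l)" by (rule descending.weq[OF eq f(3)])
    ultimately show ?thesis using f(1) by blast
  qed
qed

section \<open>Induction on the integral height\<close>

definition htn :: "bianchi_gen letter list \<Rightarrow> nat" where
  "htn w = nat \<lfloor>ht w\<rfloor>"

lemma norm_O43_nat: "z \<in> O43 \<Longrightarrow> (cmod z)\<^sup>2 = real (nat \<lfloor>(cmod z)\<^sup>2\<rfloor>)"
proof -
  assume "z \<in> O43"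
  then obtain a b where "z = zom a b" by (rule O43_cases)
  then have *: "(cmod z)\<^sup>2 = of_int (a * a + a * b + 11 * (b * b))" by (simp only: norm_zom)
  then have "0 \<le> a * a + a * b + 11 * (b * b)" by (metis of_int_0_le_iff zero_le_power2)
  then show ?thesis unfolding * floor_of_int by simp
qed

lemma ht_eq_htn: "ht w = real (htn w)"
  unfolding ht_def htn_def by (rule norm_O43_nat[OF word_matrix_entry_in_O43])

lemma ht_parabolic: "parabolic p \<Longrightarrow> ht p = 0"
  using parabolic_matrix by (simp add: ht_def)

lemma face_matrix_21: "face_row s l \<Longrightarrow> (cmod (word_matrix (face s k l) $ 2 $ 1))\<^sup>2 = of_int s * of_int s"
  using face_col[of s l k] word_col_correct[of "face s k l" 1]
  by (auto simp: norm_zom)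

lemma ht_append_face_pos:
  assumes "ht w = 0" "face_row s l"
  shows "0 < ht (w @ face s k l)"
proof -
  have c: "word_matrix w $ 2 $ 1 = 0" using assms(1) by (simp add: ht_def)
  moreover have "det (word_matrix w) = 1" using word_matrix_closed[of w] by (simp add: SL2_def)
  ultimately have "word_matrix w $ 2 $ 2 \<noteq> 0" by (auto simp: det_2)
  then show ?thesis
    using c face_matrix_21[OF assms(2), of k] face_row_pos[OF assms(2)]
    by (simp add: ht_append height_def norm_mult power_mult_distrib)
qed

lemma ht_eq_0_iff:
  assumes "descending w"
  shows "ht w = 0 \<longleftrightarrow> (\<exists>p. parabolic p \<and> w \<doteq> p)"
proof
  assume "ht w = 0"
  then have "\<not> ht v < ht w" for v by (simp add: ht_eq_htn)
  then show "\<exists>p. parabolic p \<and> w \<doteq> p" using descending_cases[OF assms] by blast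
next
  assume "\<exists>p. parabolic p \<and> w \<doteq> p"
  then obtain p where "parabolic p" "w \<doteq> p" by blast
  then show "ht w = 0" by (simp add: ht_cong[of w p] ht_parabolic)
qed

lemma descending_low_path:
  assumes move: "\<And>u m. is_move m \<Longrightarrow> descending u \<Longrightarrow> ht u < ht w \<Longrightarrow> ht (u @ move_word m) < ht w \<Longrightarrow>
      descending (u @ move_word m)"
    and path: "(low_step (word_matrix w $ 2 $ 1) (word_matrix w $ 2 $ 2))\<^sup>*\<^sup>* u v"
    and "descending (w @ u)"
  shows "descending (w @ v)"
  using path
proof induction
  case (step y z)
  let ?c = "word_matrix w $ 2 $ 1" and ?d = "word_matrix w $ 2 $ 2"
  from step.hyps(2) have "step y z" and low: "low ?c ?d y" "low ?c ?d z"
    by (auto simp: low_step_def)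
  then obtain m where m: "is_move m" "z \<doteq> y @ move_word m"
    by (auto simp: step_def)
  have eq: "w @ z \<doteq> (w @ y) @ move_word m"
    using weq_append_left[OF m(2), of w] by simp
  have "ht (w @ y) < ht w" "ht ((w @ y) @ move_word m) < ht w"
    using low ht_cong[OF eq] ht_append[of w y] ht_append[of w z] by (simp_all add: ht_def)
  then have "descending ((w @ y) @ move_word m)"
    by (rule move[OF m(1) step.IH])
  with eq show ?case by (rule descending.weq)
qed (use assms(3) in simp)

text \<open>A step of \<open>descending\<close> ends in a face, whereas a move may end in a
  translation; that translation is carried over to \<open>x\<close>, where it changes neither the
  height nor the property.\<close>

lemma descending_inverse_step:
  assumes "is_move m" "descending x" "x \<doteq> w @ move_word m" "ht x < ht w"
  shows "descending w"
proof -
  obtain p W q where m: "m = (p, W, q)" by (metis prod_cases3)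
  with assms(1) have pWq: "parabolic p" "W \<in> faces" "parabolic q" by auto
  obtain s k l where f: "face_row s l" "p @ W \<doteq> face s k l"
    using parabolic_faces_weq_face[OF pWq(1,2)] .
  have "(w @ p @ W) @ q \<doteq> x" using word_eq_sym[OF assms(3)] by (simp add: m)
  then have "w @ p @ W \<doteq> x @ winv q" by (rule word_eq_move_right)
  then have *: "w @ face s k l \<doteq> x @ winv q"
    by (rule word_eq_trans[OF weq_append_left[OF word_eq_sym[OF f(2)]]])
  have q: "parabolic (winv q)" using pWq(3) by (rule parabolic_winv)
  have "ht (w @ face s k l) < ht w"
    using ht_cong[OF *] ht_append_parabolic[OF q, of x] assms(4) by simp
  moreover have "descending (w @ face s k l)"
    by (rule descending.weq[OF * descending_append_parabolic[OF assms(2) q]])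
  ultimately show ?thesis by (rule descending.step[OF f(1)])
qed

lemma uminus_matrix_mult: "- X ** Y = - (X ** Y)" for X Y :: "complex^2^2"
  by (simp add: vec_eq_iff forall_2 matrix_mult_2_entry)

text \<open>For uniqueness, the face that starts a descent of \<open>w\<close> also lowers
  \<open>w'\<close>, as both have the same bottom row up to sign. The lowered \<open>w'\<close> is
  descending by closure under moves below \<open>n\<close>, so the induction hypothesis applies to
  both products and the face cancels.\<close>

lemma descending_main:
  "(\<forall>w w'. descending w \<longrightarrow> descending w' \<longrightarrow> htn w = n \<longrightarrow>
      word_matrix w = word_matrix w' \<or> word_matrix w = - word_matrix w' \<longrightarrow> w \<doteq> w') \<and>
   (\<forall>w m. is_move m \<longrightarrow> descending w \<longrightarrow> max (htn w) (htn (w @ move_word m)) = n \<longrightarrow>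
      descending (w @ move_word m))"
proof (induction n rule: less_induct)
  case (less n)
  have uniq: "w \<doteq> w'" if "descending w" "descending w'" "htn w < n"
    "word_matrix w = word_matrix w' \<or> word_matrix w = - word_matrix w'" for w w'
    using less.IH[OF that(3)] that by blast
  have move: "descending (u @ move_word m)"
    if "is_move m" "descending u" "ht u < n" "ht (u @ move_word m) < n" for u m
  proof -
    have "max (htn u) (htn (u @ move_word m)) < n" using that(3,4) by (simp add: ht_eq_htn)
    from less.IH[OF this] show ?thesis using that(1,2) by blast
  qed
  have along: "descending (w @ v)"
    if "ht w = n" "(low_step (word_matrix w $ 2 $ 1) (word_matrix w $ 2 $ 2))\<^sup>*\<^sup>* u v" "descending (w @ u)"
    for w u v
    by (rule descending_low_path[OF _ that(2,3)], unfold that(1)) (rule move)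
  \<comment> \<open>A descent through one low face can be exchanged for one through any other,
    because the path between them consists of moves between words of height below
    \<open>n\<close>.\<close>
  have connected: "descending (w @ face s' k' l')"
    if w: "ht w = n" "descending w" "ht w \<noteq> 0" and f': "face_row s' l'" "ht (w @ face s' k' l') < ht w"
    for w s' k' l'
  proof -
    let ?c = "word_matrix w $ 2 $ 1" and ?d = "word_matrix w $ 2 $ 2"
    have c: "?c \<noteq> 0" using w(3) by (auto simp: ht_def)
    obtain s k l where f: "face_row s l" "ht (w @ face s k l) < ht w" "descending (w @ face s k l)"
      using descending_cases[OF w(2)] ht_eq_0_iff[OF w(2)] w(3) by blast
    have "low ?c ?d (face s k l)" "low ?c ?d (face s' k' l')"
      using f(2) f'(2) unfolding ht_append by (simp_all add: ht_def)
    then have "(low_step ?c ?d)\<^sup>*\<^sup>* (face s k l) (face s' k' l')"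
      using f(1) f'(1) by (intro low_faces_connected[OF c refl refl])
    then show ?thesis using f(3) by (rule along[OF w(1)])
  qed
  show ?case
  proof (intro conjI allI impI)
    fix w w'
    assume *: "descending w" "descending w'" "htn w = n"
      "word_matrix w = word_matrix w' \<or> word_matrix w = - word_matrix w'"
    have ht': "ht w' = ht w" using *(4) by (auto simp: ht_def)
    show "w \<doteq> w'"
    proof (cases "ht w = 0")
      case True
      then obtain p p' where p: "parabolic p" "w \<doteq> p" "parabolic p'" "w' \<doteq> p'"
        using ht_eq_0_iff[OF *(1)] ht_eq_0_iff[OF *(2)] ht' by auto
      then have "word_matrix p = word_matrix p' \<or> word_matrix p = - word_matrix p'"
        using weq_word_matrix[OF p(2)] weq_word_matrix[OF p(4)] *(4) by (metis minus_minus)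
      then have "p \<doteq> p'" using p by (intro parabolic_eqI)
      then show ?thesis using p(2,4) by (simp add: word_eq_def)
    next
      case False
      then obtain s k l where f: "face_row s l" "ht (w @ face s k l) < ht w" "descending (w @ face s k l)"
        using descending_cases[OF *(1)] ht_eq_0_iff[OF *(1)] by blast
      have m: "word_matrix (w @ face s k l) = word_matrix (w' @ face s k l)
          \<or> word_matrix (w @ face s k l) = - word_matrix (w' @ face s k l)"
        using *(4) unfolding word_matrix_append by (auto simp: uminus_matrix_mult)
      then have "ht (w' @ face s k l) = ht (w @ face s k l)" by (auto simp: ht_def)
      then have less: "ht (w' @ face s k l) < ht w'" using f(2) ht' by simp
      have n: "ht w' = n" using ht' *(3) by (simp add: ht_eq_htn)
      have "ht w' \<noteq> 0" using ht' False by simp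
      then have "descending (w' @ face s k l)" by (rule connected[OF n *(2) _ f(1) less])
      moreover have "htn (w @ face s k l) < n" using f(2) *(3) by (simp add: ht_eq_htn)
      ultimately have "w @ face s k l \<doteq> w' @ face s k l" using m by (rule uniq[OF f(3)])
      then show ?thesis by (rule word_eq_cancel_right)
    qed
  next
    fix w m
    assume *: "is_move m" "descending w" "max (htn w) (htn (w @ move_word m)) = n"
    obtain p W q where m: "m = (p, W, q)" by (metis prod_cases3)
    with *(1) have pWq: "parabolic p" "W \<in> faces" "parabolic q" by auto
    obtain s k l where f: "face_row s l" "p @ W \<doteq> face s k l"
      using parabolic_faces_weq_face[OF pWq(1,2)] .
    have eq: "w @ move_word m \<doteq> (w @ face s k l) @ q"
      using weq_append_left[OF weq_append_right[OF f(2), of q], of w] by (simp add: m)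
    have ht: "ht (w @ move_word m) = ht (w @ face s k l)"
      using ht_cong[OF eq] ht_append_parabolic[OF pWq(3), of "w @ face s k l"] by simp
    have le: "ht w \<le> n" "ht (w @ face s k l) \<le> n" and eqn: "ht w = n \<or> ht (w @ face s k l) = n"
    proof -
      have "htn (w @ move_word m) = htn (w @ face s k l)" by (simp add: htn_def ht)
      then show "ht w \<le> n" "ht (w @ face s k l) \<le> n" "ht w = n \<or> ht (w @ face s k l) = n"
        using *(3) unfolding ht_eq_htn by auto
    qed
    have "descending (w @ face s k l)"
    \<comment> \<open>If \<open>w\<close> is the strictly lower end, undoing the move is itself a
      descent from the other end to \<open>w\<close>.\<close>
    proof (cases "ht w = n")
      case False
      then have "ht w < ht (w @ face s k l)" using le eqn by auto
      obtain m' where m': "is_move m'" "winv (face s k l) \<doteq> move_word m'"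
        using is_move_winv[of "(translation (k div s) (l div s), face0 s (k mod s) (l mod s), [])"]
          parabolic_translation face0_in_faces[OF f(1)] by (auto simp: face_def)
      have "w \<doteq> (w @ face s k l) @ winv (face s k l)"
        using weq_append_left[OF word_eq_reduce, of "[]" "face s k l @ winv (face s k l)" w]
        by (simp add: reduce_def[of "[]"])
      also have "\<dots> \<doteq> (w @ face s k l) @ move_word m'"
        by (rule weq_append_left[OF m'(2)])
      finally show ?thesis
        using \<open>ht w < ht (w @ face s k l)\<close> by (rule descending_inverse_step[OF m'(1) *(2)])
    next
      case True
      \<comment> \<open>From height 0 any face leads to a positive height, above
        \<open>n\<close>.\<close>
      have pos: "ht w \<noteq> 0"
        using ht_append_face_pos[OF _ f(1), of w k] le(2) True by auto
      show ?thesis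
      proof (cases "ht (w @ face s k l) = n")
        case False
        then have "ht (w @ face s k l) < ht w" using le(2) True by simp
        then show ?thesis by (rule connected[OF True *(2) pos f(1)])
      next
        \<comment> \<open>Both ends have height \<open>n\<close>. The neighbour \<open>x\<close> of
          the face given by the link is low, so \<open>w @ x\<close> is descending, and the step
          from the face to \<open>x\<close> is the strict descent that was missing.\<close>
        case bd: True
        let ?c = "word_matrix w $ 2 $ 1" and ?d = "word_matrix w $ 2 $ 2"
        have c: "?c \<noteq> 0" using pos by (auto simp: ht_def)
        have "height ?c ?d (face s k l) = (cmod ?c)\<^sup>2"
          using bd True unfolding ht_append by (simp add: ht_def)
        then obtain s' k' l' where f': "face_row s' l'" "low ?c ?d (face s' k' l')"
          "link ?c ?d (face s k l) (face s' k' l')"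
          using boundary_face_link[OF c refl refl f(1)] by blast
        then obtain x where x: "step (face s k l) x" "low ?c ?d x" "(low_step ?c ?d)\<^sup>*\<^sup>* x (face s' k' l')"
          unfolding link_def by blast
        have "ht (w @ face s' k' l') < ht w"
          using f'(2) unfolding ht_append by (simp add: ht_def)
        then have "descending (w @ face s' k' l')" by (rule connected[OF True *(2) pos f'(1)])
        then have desc: "descending (w @ x)"
          by (rule along[OF True low_path_sym[OF x(3)]])
        obtain m' where m': "is_move m'" "x \<doteq> face s k l @ move_word m'"
          using x(1) by (auto simp: step_def)
        have "w @ x \<doteq> (w @ face s k l) @ move_word m'"
          using weq_append_left[OF m'(2), of w] by simp
        moreover have "ht (w @ x) < ht (w @ face s k l)"
          using x(2) bd True unfolding ht_append by (simp add: ht_def)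
        ultimately show ?thesis by (rule descending_inverse_step[OF m'(1) desc])
      qed
    qed
    then have "descending ((w @ face s k l) @ q)"
      using pWq(3) by (rule descending_append_parabolic)
    with eq show "descending (w @ move_word m)" by (rule descending.weq)
  qed
qed

lemma descending_move: "is_move m \<Longrightarrow> descending w \<Longrightarrow> descending (w @ move_word m)"
  using descending_main by blast

text \<open>The letters that are neither translations nor faces factor through moves:
  \<open>R'\<close> is \<open>U'\<close> times the face \<open>[U, R']\<close>, \<open>S\<close> is
  \<open>B\<close> and \<open>A'\<close> times \<open>[A, B, S]\<close>, and \<open>S'\<close> is
  \<open>R'\<close> times \<open>[R, S']\<close>.\<close>

lemma descending_append_letter:
  assumes "descending w"
  shows "descending (w @ [x])"
proof -
  have move: "descending (v @ p @ W @ q)" if "descending v" "is_move (p, W, q)" for v p W q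
    using descending_move[OF that(2,1)] by simp
  have B: "descending (v @ [B])" if "descending v" for v
    using move[OF that, of "[]" "[B]" "[]"] by (simp add: faces_def)
  have R': "descending (v @ [R'])" if "descending v" for v
  proof (rule descending.weq)
    show "descending (v @ [U'] @ [U, R'] @ [])"
      by (rule move[OF that]) (simp add: faces_def)
    show "v @ [R'] \<doteq> v @ [U'] @ [U, R'] @ []"
      by (intro weq_append_left word_eq_reduce) (simp add: word_eval)
  qed
  show ?thesis
  proof (cases "x \<in> {A, A', U, U'}")
    case True
    then show ?thesis using assms by (intro descending_append_parabolic) auto
  next
    case False
    obtain g where "x = Gen g \<or> x = Inv g" by (cases x) auto
    then consider "x = B" | "x = B'" | "x = R" | "x = R'" | "x = S" | "x = S'"
      using False by (cases g) auto
    then show ?thesis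
    proof cases
      case 1
      then show ?thesis using B assms by simp
    next
      case 2
      have "w @ [B'] \<doteq> w @ [B]"
        by (intro weq_append_left word_eq_conj_prod[of "[([], [B, B], False)]"])
          (simp_all add: trivial_words word_eval)
      then show ?thesis unfolding 2 using B[OF assms] by (rule descending.weq)
    next
      case 3
      then show ?thesis using move[OF assms, of "[]" "[R]" "[]"] by (simp add: faces_def)
    next
      case 4
      then show ?thesis using R' assms by simp
    next
      case 5
      have "w @ [S] \<doteq> (w @ [B]) @ [A'] @ [A, B, S] @ []"
        unfolding append_assoc
        by (intro weq_append_left word_eq_conj_prod[of "[([], [B, B], False)]"])
          (simp_all add: trivial_words word_eval)
      then show ?thesis
        unfolding 5 by (rule descending.weq) (rule move[OF B[OF assms]], simp add: faces_def)
    next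
      case 6
      have "w @ [S'] \<doteq> (w @ [R']) @ [] @ [R, S'] @ []"
        unfolding append_assoc
        by (intro weq_append_left word_eq_reduce) (simp add: word_eval)
      then show ?thesis
        unfolding 6 by (rule descending.weq) (rule move[OF R'[OF assms]], simp add: faces_def)
    qed
  qed
qed

lemma descending_all: "descending w"
proof (induction w rule: rev_induct)
  case Nil
  show ?case by (rule descending.base) simp
next
  case (snoc x w)
  then show ?case by (rule descending_append_letter)
qed

lemma weq_Nil_if_word_matrix:
  assumes "word_matrix w = mat 1 \<or> word_matrix w = - mat 1"
  shows "w \<doteq> []"
proof -
  have "word_matrix w = word_matrix [] \<or> word_matrix w = - word_matrix []"
    using assms by simp
  then show ?thesis
    using conjunct1[OF descending_main, rule_format, OF descending_all descending_all refl] by blast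
qed

section \<open>Generation\<close>

lemma unit_O43:
  assumes "x \<in> O43" "y \<in> O43" "x * y = 1"
  shows "x = 1 \<and> y = 1 \<or> x = -1 \<and> y = -1"
proof -
  obtain a b e f where x: "x = zom a b" and y: "y = zom e f" using assms(1,2) O43_cases by metis
  let ?n = "a * a + a * b + 11 * (b * b)" and ?m = "e * e + e * f + 11 * (f * f)"
  have "real_of_int (?n * ?m) = (cmod (x * y))\<^sup>2"
    unfolding x y norm_mult power_mult_distrib norm_zom by simp
  then have "real_of_int (?n * ?m) = 1" by (simp only: assms(3) norm_one power_one)
  then have "?n * ?m = 1" by (simp only: of_int_eq_1_iff)
  then have "?n = 1 \<or> ?n = - 1" using zmult_eq_1_iff by blast
  moreover have "0 \<le> ?n"
    using norm_zom[of a b] by (metis of_int_0_le_iff zero_le_power2)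
  ultimately have "?n = 1" by linarith
  \<comment> \<open>Four times the norm form, with the square completed; a nonzero \<open>b\<close>
    would make the left side at least 43.\<close>
  then have *: "(2 * a + b)\<^sup>2 + 43 * b\<^sup>2 = 4" by (simp add: power2_eq_square algebra_simps)
  have "b = 0"
  proof (rule ccontr)
    assume "b \<noteq> 0"
    then have "1 \<le> b\<^sup>2" by (simp add: int_one_le_iff_zero_less)
    then show False using * zero_le_power2[of "2 * a + b"] by linarith
  qed
  then have "a * a = 1" using \<open>?n = 1\<close> by simp
  then have "a = 1 \<or> a = -1" by (simp add: zmult_eq_1_iff)
  then have "x = 1 \<or> x = -1" using \<open>b = 0\<close> by (auto simp: x)
  then show ?thesis
  proof
    assume x: "x = -1"
    then have "y = - (x * y)" by simp
    then show ?thesis unfolding assms(3) using x by simp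
  qed (use assms(3) in simp)
qed

lemma SL2_generated:
  assumes "M \<in> carrier (SL2 O43)"
  shows "\<exists>w. word_matrix w = M \<or> word_matrix w = - M"
  using assms
proof (induction "nat \<lfloor>(cmod (M $ 2 $ 1))\<^sup>2\<rfloor>" arbitrary: M rule: less_induct)
  case less
  interpret group "SL2 O43" by (rule group_SL2_43)
  have ent: "M $ i $ j \<in> O43" for i j
    using less.prems by (simp add: SL2_def)
  have det: "M $ 1 $ 1 * M $ 2 $ 2 - M $ 1 $ 2 * M $ 2 $ 1 = 1"
    using less.prems by (simp add: SL2_def det_2)
  show ?case
  proof (cases "M $ 2 $ 1 = 0")
    case True
    then have diag: "M $ 1 $ 1 = 1 \<and> M $ 2 $ 2 = 1 \<or> M $ 1 $ 1 = -1 \<and> M $ 2 $ 2 = -1"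
      using det unit_O43[OF ent ent] by simp
    have "\<exists>w. word_matrix w = N" if N: "N $ 1 $ 1 = 1" "N $ 2 $ 1 = 0" "N $ 2 $ 2 = 1" "N $ 1 $ 2 \<in> O43"
      for N :: "complex^2^2"
    proof -
      obtain k l where "N $ 1 $ 2 = zom k l" using O43_cases[OF N(4)] .
      then have "word_matrix (translation k l) = N"
        using N(1-3) parabolic_matrix[OF parabolic_translation] translation_matrix
        by (simp add: vec_eq_iff forall_2)
      then show ?thesis by blast
    qed
    \<comment> \<open>The diagonal is 1 for either \<open>M\<close> or its negative, as the only
      units are 1 and -1.\<close>
    from this[of M] this[of "- M"] show ?thesis
      using diag True ent[of 1 2] quadratic_integers_43_minus by auto
  next
    case False
    obtain s k l where f: "face_row s l" "low (M $ 2 $ 1) (M $ 2 $ 2) (face s k l)"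
      using low_face_exists[OF False refl refl] by blast
    let ?F = "word_matrix (face s k l)"
    have F: "?F \<in> carrier (SL2 O43)" by (rule word_matrix_closed)
    have MF: "M ** ?F \<in> carrier (SL2 O43)" using m_closed[OF less.prems F] by simp
    then have entF: "(M ** ?F) $ 2 $ 1 \<in> O43" by (simp add: SL2_def)
    have "(cmod ((M ** ?F) $ 2 $ 1))\<^sup>2 < (cmod (M $ 2 $ 1))\<^sup>2"
      using f(2) by (simp add: height_def matrix_mult_2_entry)
    then have "nat \<lfloor>(cmod ((M ** ?F) $ 2 $ 1))\<^sup>2\<rfloor> < nat \<lfloor>(cmod (M $ 2 $ 1))\<^sup>2\<rfloor>"
      using norm_O43_nat[OF entF] norm_O43_nat[OF ent[of 2 1]] by linarith
    from less.hyps[OF this MF] obtain w where w: "word_matrix w = M ** ?F \<or> word_matrix w = - (M ** ?F)"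
      by blast
    have inv: "?F ** word_matrix (winv (face s k l)) = mat 1"
      using r_inv[OF F] by (simp add: word_value_winv gen_matrix_in_SL2)
    have "(M ** ?F) ** word_matrix (winv (face s k l)) = M"
      unfolding matrix_mul_assoc[symmetric] inv by simp
    then have "word_matrix (w @ winv (face s k l)) = M \<or> word_matrix (w @ winv (face s k l)) = - M"
      using w unfolding word_matrix_append by (auto simp: uminus_matrix_mult)
    then show ?thesis by blast
  qed
qed

theorem mainTheorem1:
  shows "has_presentation (PSL2 (quadratic_integers (-43))) bianchi_relators
    (\<lambda>x. PSL2_class (quadratic_integers (-43)) (gen_matrix x))"
proof (rule group.has_presentationI[OF group_PSL2_43])
  show "\<forall>x. PSL2_class O43 (gen_matrix x) \<in> carrier (PSL2 O43)"
    by (simp add: PSL2_class_in_carrier gen_matrix_in_SL2)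
  show "word_value (PSL2 O43) (\<lambda>x. PSL2_class O43 (gen_matrix x)) r = \<one>\<^bsub>PSL2 O43\<^esub>"
    if "r \<in> bianchi_relators" for r
    using that by (rule relator_value_PSL2)
next
  fix w assume "word_value (PSL2 O43) (\<lambda>x. PSL2_class O43 (gen_matrix x)) w = \<one>\<^bsub>PSL2 O43\<^esub>"
  then have "PSL2_class O43 (word_matrix w) = PSL2_class O43 (word_matrix [])"
    using word_value_PSL2[of w] word_value_PSL2[of "[]"] by simp
  then show "w \<doteq> []"
    using PSL2_class_eq_iff[OF word_matrix_closed word_matrix_closed, of w "[]"]
    by (intro weq_Nil_if_word_matrix) simp
next
  fix g assume "g \<in> carrier (PSL2 O43)"
  then obtain M where M: "M \<in> carrier (SL2 O43)" "g = PSL2_class O43 M"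
    by (auto simp: carrier_PSL2)
  obtain w where "word_matrix w = M \<or> word_matrix w = - M"
    using SL2_generated[OF M(1)] by blast
  then show "\<exists>w. word_value (PSL2 O43) (\<lambda>x. PSL2_class O43 (gen_matrix x)) w = g"
    using PSL2_class_eq_iff[OF word_matrix_closed M(1), of w] M(2)
    by (intro exI[of _ w]) (simp add: word_value_PSL2)
qed

end
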